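(* If $w\in\{A,B,C,D\}^{\mathbb{Z}}$ is an infinitely coherent word, then each finite subword of $w$ is realized by a periodic linear trajectory in the regular octagon (i.e. it is the cutting sequence of a finite piece of a periodic trajectory). In particular, if $w$ is infinitely coherent with respect to $\{s_k\}_{k\in\mathbb{N}}\in S^*$, then each finite subword of $w$ occurs as a subword of some periodic cutting sequence in $$\bigcup_{k\in\mathbb{N}}\mathscr{P}(s_0,\dots,s_k).$$
   Context: **Octagon and cutting sequences.** Let $O\subset\mathbb{R}^2$ be the regular octagon centred at the origin with unit sides, two of them horizontal, and vertices $O_1,\dots,O_8$ in clockwise order, $\overline{O_1O_2}$ being the top horizontal side. Opposite sides are identified by translation, and the pairs of identified sides are labelled: $\overline{O_1O_2},\overline{O_5O_6}$ by $A$; $\overline{O_2O_3},\overline{O_6O_7}$ by $B$; $\overline{O_3O_4},\overline{O_7O_8}$ by $C$; $\overline{O_4O_5},\overline{O_8O_1}$ by $D$. A (bi-infinite) linear trajectory moves with constant velocity; when it hits a side it re-enters $O$ at the corresponding point of the opposite side with the same velocity; it never hits a vertex and is defined for all times. Its cutting sequence $c(\tau)$ is the bi-infinite word of labels of sides crossed (considered up to shift). **Permutations and diagrams.** $\pi_0=\mathrm{Id}$, $\pi_1=(AD)(BC)$, $\pi_2=(ABCD)$, $\pi_3=(AC)$, $\pi_4=(AC)(BD)$, $\pi_5=(AB)(CD)$, $\pi_6=(ADCB)$, $\pi_7=(BD)$ (cycle notation: $(ABCD)$ sends $A\mapsto B\mapsto C\mapsto D\mapsto A$), acting on words letter by letter.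 A word (finite or infinite) is admissible in diagram $0$ if every pair of consecutive letters belongs to $\{AD,DA,DB,BD,BC,CB,CC\}$; it is admissible in diagram $i$ ($0\le i\le7$) if $\pi_i\cdot w$ is admissible in diagram $0$; admissible if admissible in some diagram. **Derivation.** A letter occurrence in a word is sandwiched if the letters immediately before and after it are equal; it is $L'$-sandwiched if both equal $L'$. The derived sequence $w'$ of a bi-infinite word keeps only the sandwiched letters. $w$ is derivable if $w,w'$ are admissible, infinitely derivable if $w$ and all its iterated derived sequences are derivable. **Coherence.** A derivable word $w$ is coherent with respect to $(i,j)$ if: (C0) $w$ is admissible in diagram $i$; and, with $n(w):=\pi_i\cdot w$: (C1) there is $k\in\{0,1,2,3\}$ such that all sandwiched letters occurring in $n(w)$ belong to $G_k$, where $G_0=\{D$-sandwiched $A$, $C$-sandwiched $B$, $B$-sandwiched $C$, $A$-sandwiched $D\}$, $G_1=\{D$-sandwiched $A$, $C$-sandwiched $B$, $B$-sandwiched $C$, $B$-sandwiched $D\}$, $G_2=\{D$-sandwiched $A$, $C$-sandwiched $B$, $C$-sandwiched $C$, $B$-sandwiched $D\}$, $G_3=\{D$-sandwiched $A$, $D$-sandwiched $B$, $C$-sandwiched $C$, $B$-sandwiched $D\}$; (C2) $n(w)'$ is admissible in diagram $j$, $j\in\{1,\dots,7\}$; (C3) $k=[j/2]$. **Infinite coherence.** $S^*$ is the set of sequences $s=\{s_k\}_{k\in\mathbb{N}}$ with $s_0\in\{0,\dots,7\}$ and $s_k\in\{1,\dots,7\}$ for $k\ge1$. Given $w$ and $s\in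 S^*$, put $w_0:=w$, $w_k:=(\pi_{s_{k-1}}\cdot w_{k-1})'$. $w$ is infinitely coherent with respect to $s$ if it is infinitely derivable and each $w_k$ is coherent with respect to $(s_k,s_{k+1})$; it is infinitely coherent if it is so with respect to some $s\in S^*$. **Generation operators.** For $1\le k\le7$ and a letter $L$, let $p_k(L)$ be the letter such that "$p_k(L)$-sandwiched $L$" is in $G_{[k/2]}$. For each transition $LL'$ admissible in diagram $k$, the interpolating word $w^k_{LL'}$ is the unique (possibly empty) finite word such that the word $L\,w^k_{LL'}\,L'$ is admissible in diagram $0$, has second letter $p_k(L)$ and penultimate letter $p_k(L')$, and none of the letters of $w^k_{LL'}$ is sandwiched in $L\,w^k_{LL'}\,L'$. (E.g. $w^3_{DB}=BCC$, $w^3_{AA}=DBCCBD$, $w^3_{CD}=B$.) For $u=\dots L_1L_2L_3\dots$ admissible in diagram $k$, $\mathfrak{g}^0_k u:=\dots L_1\,w^k_{L_1L_2}\,L_2\,w^k_{L_2L_3}\,L_3\dots$, and $\mathfrak{g}^i_k u:=\pi_i^{-1}\cdot\mathfrak{g}^0_ku$ for $0\le i\le7$ (which is admissible in diagram $i$). Let $\mathscr{P}_k$ be the set of periodic bi-infinite words of period $1$ or $2$ admissible in diagram $k$, and for $s_0\in\{0,\dots,7\}$, $s_1,\dots,s_k\in\{1,\dots,7\}$ let $\mathscr{P}(s_0,\dots,s_k):=\{\mathfrak{g}^{s_0}_{s_1}\mathfrak{g}^{s_1}_{s_2}\cdots\mathfrak{g}^{s_{k-1}}_{s_k}u:\ u\in\mathscr{P}_{s_k}\}$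 (for $k=0$ this is $\mathscr{P}_{s_0}$). It is a fact that the elements of these sets are cutting sequences of periodic trajectories. *)

theory Defs
  imports "HOL-Analysis.Analysis" "HOL-Combinatorics.Cycles" "HOL-Library.Infinite_Set"
begin

datatype letter = A | B | C | D

section \<open>Linear trajectories in the regular octagon\<close>

text \<open>The plane is \<^typ>\<open>complex\<close>. The vertices are numbered clockwise from the upper left
  one, with \<open>vertex 9 = vertex 1\<close>; the circumradius of the octagon with unit sides is
  \<open>1 / (2 sin (\<pi>/8))\<close>.\<close>

definition vertex :: "nat \<Rightarrow> complex" where
  "vertex j = cis (5 * pi / 8 - (real j - 1) * pi / 4) / of_real (2 * sin (pi / 8))"

definition octagon :: "complex set" where
  "octagon = convex hull (vertex ` {1..8})"

definition side :: "nat \<Rightarrow> complex set" where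
  "side j = open_segment (vertex j) (vertex (j + 1))"

definition side_label :: "nat \<Rightarrow> letter" where
  "side_label j = [A, B, C, D] ! ((j - 1) mod 4)"

text \<open>By central symmetry, the translation that identifies side \<open>j\<close> with the opposite side sends
  \<open>vertex j\<close> to \<open>vertex (j + 5) = - vertex (j + 1)\<close>.\<close>

definition glue :: "nat \<Rightarrow> complex \<Rightarrow> complex" where
  "glue j p = p - (vertex j + vertex (j + 1))"

text \<open>\<open>\<tau>\<close> is a bi-infinite linear trajectory, parametrised by time, whose \<open>n\<close>-th crossing takes
  place at time \<open>t n\<close> through the side \<open>\<sigma> n\<close>. At a crossing time the value of \<open>\<tau>\<close> is the
  point at which the trajectory re-enters the octagon, so that \<open>\<tau>\<close> is continuous from the
  right. Sides are taken without end points, so vertices are never hit; the crossing times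
  exhaust the line, so the trajectory is defined for all times.\<close>

definition crossings :: "(real \<Rightarrow> complex) \<Rightarrow> (int \<Rightarrow> real) \<Rightarrow> (int \<Rightarrow> nat) \<Rightarrow> bool" where
  "crossings \<tau> t \<sigma> \<longleftrightarrow>
     strict_mono t \<and> filterlim t at_top at_top \<and> filterlim t at_bot at_bot \<and>
     (\<forall>n. \<sigma> n \<in> {1..8}) \<and>
     (\<exists>v. v \<noteq> 0 \<and>
       (\<forall>n. (\<forall>r\<in>{t n..<t (n + 1)}. \<tau> r = \<tau> (t n) + (r - t n) *\<^sub>R v) \<and>
            (\<forall>r\<in>{t n<..<t (n + 1)}. \<tau> r \<in> interior octagon) \<and>
            (let q = \<tau> (t n) + (t (n + 1) - t n) *\<^sub>R v
             in q \<in> side (\<sigma> (n + 1)) \<and> \<tau> (t (n + 1)) = glue (\<sigma> (n + 1)) q)))"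

definition linear_trajectory :: "(real \<Rightarrow> complex) \<Rightarrow> bool" where
  "linear_trajectory \<tau> \<longleftrightarrow> (\<exists>t \<sigma>. crossings \<tau> t \<sigma>)"

definition periodic_trajectory :: "(real \<Rightarrow> complex) \<Rightarrow> bool" where
  "periodic_trajectory \<tau> \<longleftrightarrow> linear_trajectory \<tau> \<and> (\<exists>T>0. \<forall>r. \<tau> (r + T) = \<tau> r)"

text \<open>The numbering of the crossings is free, so \<open>c\<close> is determined by \<open>\<tau>\<close> up to shift.\<close>

definition cutting_sequence :: "(real \<Rightarrow> complex) \<Rightarrow> (int \<Rightarrow> letter) \<Rightarrow> bool" where
  "cutting_sequence \<tau> c \<longleftrightarrow> (\<exists>t \<sigma>. crossings \<tau> t \<sigma> \<and> c = side_label \<circ> \<sigma>)"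

text \<open>\<open>u\<close> is the word of labels of the sides crossed by the trajectory \<open>\<tau>\<close> in the time
  interval \<open>[a, b]\<close>.\<close>

definition piece_cutting_word :: "(real \<Rightarrow> complex) \<Rightarrow> real \<Rightarrow> real \<Rightarrow> letter list \<Rightarrow> bool" where
  "piece_cutting_word \<tau> a b u \<longleftrightarrow>
     (\<exists>t \<sigma> m l. crossings \<tau> t \<sigma> \<and> {n. a \<le> t n \<and> t n \<le> b} = {m..l} \<and>
        u = map (side_label \<circ> \<sigma>) [m..l])"

definition realized_by_periodic_trajectory :: "letter list \<Rightarrow> bool" where
  "realized_by_periodic_trajectory u \<longleftrightarrow>
     (\<exists>\<tau> a b. periodic_trajectory \<tau> \<and> a \<le> b \<and> piece_cutting_word \<tau> a b u)"

section \<open>Words and diagrams\<close>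

definition subword :: "'a list \<Rightarrow> (int \<Rightarrow> 'a) \<Rightarrow> bool" where
  "subword u w \<longleftrightarrow> (\<exists>m l. u = map w [m..l])"

definition perm :: "nat \<Rightarrow> letter \<Rightarrow> letter" where
  "perm i =
     [id,
      cycle_of_list [A, D] \<circ> cycle_of_list [B, C],
      cycle_of_list [A, B, C, D],
      cycle_of_list [A, C],
      cycle_of_list [A, C] \<circ> cycle_of_list [B, D],
      cycle_of_list [A, B] \<circ> cycle_of_list [C, D],
      cycle_of_list [A, D, C, B],
      cycle_of_list [B, D]] ! i"

definition trans0 :: "letter \<Rightarrow> letter \<Rightarrow> bool" where
  "trans0 x y \<longleftrightarrow> (x, y) \<in> {(A, D), (D, A), (D, B), (B, D), (B, C), (C, B), (C, C)}"

definition admissible_in :: "nat \<Rightarrow> (int \<Rightarrow> letter) \<Rightarrow> bool" where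
  "admissible_in i w \<longleftrightarrow> (\<forall>n. trans0 (perm i (w n)) (perm i (w (n + 1))))"

definition admissible :: "(int \<Rightarrow> letter) \<Rightarrow> bool" where
  "admissible w \<longleftrightarrow> (\<exists>i\<le>7. admissible_in i w)"

section \<open>Derivation and coherence\<close>

definition sandwiched :: "(int \<Rightarrow> 'a) \<Rightarrow> int \<Rightarrow> bool" where
  "sandwiched w n \<longleftrightarrow> w (n - 1) = w (n + 1)"

text \<open>The word of sandwiched letters in their order; two increasing enumerations of the sandwiched
  positions differ by a shift, so this is well defined up to shift. By the lemma
  \<open>sandwiched_enumeration\<close> below, an enumeration exists when \<open>w\<close> is admissible, and only derived
  sequences of admissible words matter in what follows.\<close>

definition derived :: "(int \<Rightarrow> 'a) \<Rightarrow> int \<Rightarrow> 'a" where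
  "derived w = w \<circ> (SOME e. strict_mono e \<and> range e = {n. sandwiched w n})"

definition derivable :: "(int \<Rightarrow> letter) \<Rightarrow> bool" where
  "derivable w \<longleftrightarrow> admissible w \<and> admissible (derived w)"

definition infinitely_derivable :: "(int \<Rightarrow> letter) \<Rightarrow> bool" where
  "infinitely_derivable w \<longleftrightarrow> (\<forall>n. derivable ((derived ^^ n) w))"

text \<open>The pair \<open>(L', L)\<close> stands for ``\<open>L'\<close>-sandwiched \<open>L\<close>''.\<close>

definition sandwich_class :: "nat \<Rightarrow> (letter \<times> letter) set" where
  "sandwich_class k =
     [{(D, A), (C, B), (B, C), (A, D)},
      {(D, A), (C, B), (B, C), (B, D)},
      {(D, A), (C, B), (C, C), (B, D)},
      {(D, A), (D, B), (C, C), (B, D)}] ! k"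

definition coherent :: "(int \<Rightarrow> letter) \<Rightarrow> nat \<Rightarrow> nat \<Rightarrow> bool" where
  "coherent w i j \<longleftrightarrow>
     derivable w \<and> admissible_in i w \<and>
     (let v = perm i \<circ> w in
       \<exists>k\<in>{0..3}. (\<forall>n. sandwiched v n \<longrightarrow> (v (n - 1), v n) \<in> sandwich_class k) \<and>
         j \<in> {1..7} \<and> admissible_in j (derived v) \<and> k = j div 2)"

definition Sstar :: "(nat \<Rightarrow> nat) set" where
  "Sstar = {s. s 0 \<in> {0..7} \<and> (\<forall>k\<ge>1. s k \<in> {1..7})}"

primrec coherence_word :: "(nat \<Rightarrow> nat) \<Rightarrow> (int \<Rightarrow> letter) \<Rightarrow> nat \<Rightarrow> int \<Rightarrow> letter" where
  "coherence_word s w 0 = w"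
| "coherence_word s w (Suc k) = derived (perm (s k) \<circ> coherence_word s w k)"

definition infinitely_coherent_wrt :: "(int \<Rightarrow> letter) \<Rightarrow> (nat \<Rightarrow> nat) \<Rightarrow> bool" where
  "infinitely_coherent_wrt w s \<longleftrightarrow>
     infinitely_derivable w \<and> (\<forall>k. coherent (coherence_word s w k) (s k) (s (Suc k)))"

definition infinitely_coherent :: "(int \<Rightarrow> letter) \<Rightarrow> bool" where
  "infinitely_coherent w \<longleftrightarrow> (\<exists>s\<in>Sstar. infinitely_coherent_wrt w s)"

section \<open>Generation\<close>

definition sandwiching_letter :: "nat \<Rightarrow> letter \<Rightarrow> letter" where
  "sandwiching_letter k x = (THE y. (y, x) \<in> sandwich_class (k div 2))"

text \<open>In the definition below, \<open>xs\<close> has at least two letters, and its inner letters are exactly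
  those of the interpolating word \<open>u\<close>.\<close>

definition interpolates :: "nat \<Rightarrow> letter \<Rightarrow> letter \<Rightarrow> letter list \<Rightarrow> bool" where
  "interpolates k x y u \<longleftrightarrow>
     (let xs = x # u @ [y] in
       successively trans0 xs \<and>
       xs ! 1 = sandwiching_letter k x \<and>
       xs ! (length xs - 2) = sandwiching_letter k y \<and>
       (\<forall>i. 0 < i \<and> i < length xs - 1 \<longrightarrow> xs ! (i - 1) \<noteq> xs ! (i + 1)))"

definition interpolating_word :: "nat \<Rightarrow> letter \<Rightarrow> letter \<Rightarrow> letter list" where
  "interpolating_word k x y = (THE u. interpolates k x y u)"

text \<open>Concatenation of a bi-infinite sequence of nonempty blocks, the block \<open>b 0\<close> starting at
  position \<open>0\<close>.\<close>

definition block_start :: "(int \<Rightarrow> 'a list) \<Rightarrow> int \<Rightarrow> int" where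
  "block_start b n =
     (if 0 \<le> n then \<Sum>i\<in>{0..<n}. int (length (b i)) else - (\<Sum>i\<in>{n..<0}. int (length (b i))))"

definition bi_concat :: "(int \<Rightarrow> 'a list) \<Rightarrow> int \<Rightarrow> 'a" where
  "bi_concat b m =
     (let n = (THE n. block_start b n \<le> m \<and> m < block_start b (n + 1))
      in b n ! nat (m - block_start b n))"

definition gen0 :: "nat \<Rightarrow> (int \<Rightarrow> letter) \<Rightarrow> int \<Rightarrow> letter" where
  "gen0 k u = bi_concat (\<lambda>n. u n # interpolating_word k (u n) (u (n + 1)))"

definition gen :: "nat \<Rightarrow> nat \<Rightarrow> (int \<Rightarrow> letter) \<Rightarrow> int \<Rightarrow> letter" where
  "gen i k u = inv (perm i) \<circ> gen0 k u"

primrec gen_iter :: "(nat \<Rightarrow> nat) \<Rightarrow> nat \<Rightarrow> (int \<Rightarrow> letter) \<Rightarrow> int \<Rightarrow> letter" where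
  "gen_iter s 0 u = u"
| "gen_iter s (Suc k) u = gen_iter s k (gen (s k) (s (Suc k)) u)"

definition periodic_words :: "nat \<Rightarrow> (int \<Rightarrow> letter) set" where
  "periodic_words k = {u. admissible_in k u \<and> (\<exists>p\<in>{1, 2}. \<forall>n. u (n + p) = u n)}"

text \<open>\<open>generated_words s k\<close> depends on \<open>s 0, \<dots>, s k\<close> only.\<close>

definition generated_words :: "(nat \<Rightarrow> nat) \<Rightarrow> nat \<Rightarrow> (int \<Rightarrow> letter) set" where
  "generated_words s k = gen_iter s k ` periodic_words (s k)"

section \<open>Existence of derived sequences\<close>

lemma bij_perm: "i \<le> 7 \<Longrightarrow> bij (perm i)"
proof -
  assume "i \<le> 7"
  then have "i \<in> {0, 1, 2, 3, 4, 5, 6, 7}" by auto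
  moreover have "bij (cycle_of_list cs)" for cs :: "letter list"
    using permutation_bijective[OF permutation_of_cycle] .
  ultimately show ?thesis
    unfolding perm_def by (elim insertE emptyE) (simp_all add: bij_comp del: cycle_of_list.simps)
qed

lemma sandwiched_in_window:
  assumes w: "admissible w"
  shows "\<exists>m\<in>{n..n + 6}. sandwiched w m"
proof (rule ccontr)
  assume *: "\<not> ?thesis"
  obtain i where i: "i \<le> 7" "admissible_in i w" using w by (auto simp: admissible_def)
  define v where "v = perm i \<circ> w"
  have adm: "trans0 (v m) (v (m + 1))" for m using i by (simp add: admissible_in_def v_def)
  have "\<not> sandwiched v m" if "m \<in> {n..n + 6}" for m
    using * that bij_is_inj[OF bij_perm[OF i(1)]] by (auto simp: sandwiched_def v_def inj_eq)
  then have ne: "v (m - 1) \<noteq> v (m + 1)" if "n \<le> m" "m \<le> n + 6" for m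
    using that by (auto simp: sandwiched_def)
  define r where "r x y = (case (x, y) of (A, D) \<Rightarrow> 7 | (D, B) \<Rightarrow> 6 | (B, C) \<Rightarrow> 5 | (C, C) \<Rightarrow> 4
    | (C, B) \<Rightarrow> 3 | (B, D) \<Rightarrow> 2 | (D, A) \<Rightarrow> 1 | _ \<Rightarrow> (0::nat))" for x y
  have step: "r y z < r x y" if "trans0 x y" "trans0 y z" "x \<noteq> z" for x y z
    using that by (cases x; cases y; cases z) (simp_all add: trans0_def r_def)
  have r_bounds: "0 < r x y \<and> r x y \<le> 7" if "trans0 x y" for x y
    using that by (cases x; cases y) (simp_all add: trans0_def r_def)
  have decreasing: "r (v m) (v (m + 1)) < r (v (m - 1)) (v m)" if "n \<le> m" "m \<le> n + 6" for m
    using step[OF _ adm ne[OF that]] adm[of "m - 1"] by simp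
  have "r (v (n + int k - 1)) (v (n + int k)) + k \<le> 7" if "k \<le> 7" for k
    using that
  proof (induction k)
    case 0
    then show ?case using r_bounds[OF adm[of "n - 1"]] by simp
  next
    case (Suc k)
    then show ?case using decreasing[of "n + int k"] by (simp add: algebra_simps)
  qed
  from this[of 7] show False using r_bounds[OF adm[of "n + 6"]] by (simp add: algebra_simps)
qed

lemma int_enumeration:
  fixes S :: "int set"
  assumes up: "\<And>n. \<exists>m\<ge>n. m \<in> S" and down: "\<And>n. \<exists>m\<le>n. m \<in> S"
  shows "\<exists>e::int \<Rightarrow> int. strict_mono e \<and> range e = S"
proof -
  define P where "P = {k. int k \<in> S}"
  define N where "N = {k. - 1 - int k \<in> S}"
  have "\<exists>k\<ge>n. k \<in> P" for n
  proof -
    obtain m where m: "m \<ge> int n" "m \<in> S" using up by blast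
    then have "nat m \<ge> n" "nat m \<in> P" by (auto simp: P_def)
    then show ?thesis by blast
  qed
  then have P: "infinite P" unfolding infinite_nat_iff_unbounded_le by blast
  have "\<exists>k\<ge>n. k \<in> N" for n
  proof -
    obtain m where m: "m \<le> - 1 - int n" "m \<in> S" using down by blast
    then have "nat (- 1 - m) \<ge> n" "nat (- 1 - m) \<in> N" by (auto simp: N_def)
    then show ?thesis by blast
  qed
  then have N: "infinite N" unfolding infinite_nat_iff_unbounded_le by blast
  define e where "e n = (if 0 \<le> n then int (enumerate P (nat n))
                         else - 1 - int (enumerate N (nat (- 1 - n))))" for n :: int
  have "strict_mono e"
  proof (rule strict_monoI)
    fix x y :: int assume "x < y"
    then consider "0 \<le> x" "nat x < nat y" | "x < 0" "0 \<le> y"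
      | "y < 0" "nat (- 1 - y) < nat (- 1 - x)" by linarith
    then show "e x < e y"
    proof cases
      case 1
      then show ?thesis using enumerate_mono[OF 1(2) P] by (simp add: e_def)
    next
      case 2
      then show ?thesis by (simp add: e_def)
    next
      case 3
      then show ?thesis using enumerate_mono[OF 3(2) N] by (simp add: e_def)
    qed
  qed
  moreover have "range e = S"
  proof (intro equalityI subsetI)
    fix x assume "x \<in> range e"
    then obtain n where n: "x = e n" by blast
    have "int (enumerate P m) \<in> S" "- 1 - int (enumerate N m) \<in> S" for m
      using enumerate_in_set[OF P, of m] enumerate_in_set[OF N, of m]
      unfolding P_def N_def by simp_all
    then show "x \<in> S" by (simp add: n e_def)
  next
    fix x assume x: "x \<in> S"
    show "x \<in> range e"
    proof (cases "0 \<le> x")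
      case True
      then have "nat x \<in> P" using x by (simp add: P_def)
      then obtain k where "enumerate P k = nat x" using enumerate_Ex[OF P] by blast
      then have "e (int k) = x" using True by (simp add: e_def)
      then show ?thesis by (metis rangeI)
    next
      case False
      then have "nat (- 1 - x) \<in> N" using x by (simp add: N_def)
      then obtain k where "enumerate N k = nat (- 1 - x)" using enumerate_Ex[OF N] by blast
      then have "e (- 1 - int k) = x" using False by (simp add: e_def)
      then show ?thesis by (metis rangeI)
    qed
  qed
  ultimately show ?thesis by blast
qed

lemma sandwiched_enumeration:
  assumes "admissible w"
  shows "\<exists>e::int \<Rightarrow> int. strict_mono e \<and> range e = {n. sandwiched w n}"
proof (rule int_enumeration)
  show "\<exists>m\<ge>n. m \<in> {n. sandwiched w n}" for n
    using sandwiched_in_window[OF assms, of n] by auto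
  show "\<exists>m\<le>n. m \<in> {n. sandwiched w n}" for n
    using sandwiched_in_window[OF assms, of "n - 6"] by auto
qed

end

theory Submission
  imports Defs
begin

text \<open>Two things have to be shown: a finite piece of an infinitely coherent word occurs in a generated
  word, and every generated word is the cutting sequence of a periodic trajectory.

  If \<open>w\<close> is coherent with respect to \<open>(i, j)\<close>, then \<open>\<pi>\<^sub>i \<cdot> w\<close> is
  recovered from its derived sequence by inserting the interpolating words (\<open>desubstitution\<close>): a
  word admissible in diagram 0 in which no letter is sandwiched is a factor of the palindrome
  \<open>ADBCCBDA\<close>, so the letters between two consecutive sandwiched ones are forced. Hence a window of
  \<open>w\<close> lies in the expansion of a window of the derived sequence, and the latter has fewer inner
  letters unless every inner letter of the window is sandwiched. In that exceptional case the
  window alternates between two letters and is part of a word of period 1 or 2. Induction on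
  the length of the window ends in this case (\<open>coherent_window\<close>).

  For the second part, record a trajectory with direction in \<open>[0, \<pi>/8]\<close> by the signed
  distances, measured across the direction, between its crossing points and the midpoints of the
  sides. From one crossing to the next this offset changes by the sum of the two midpoint heights,
  so trajectories become orbits of an interval exchange whose interval lengths are the heights of
  the four sides (\<open>octagon_coded\<close>). For words of period 1 or 2 the offset 0 works, that is,
  the trajectory runs through midpoints of sides. The generation operator corresponds to the affine
  automorphism of the octagon surface with derivative matrix \<open>(-1, 2 + 2\<surd>2; 0, 1)\<close>: it keeps the
  offsets up to sign and changes the heights linearly, and linear inequalities show that the lifted
  orbit crosses the sides prescribed by the interpolating words (\<open>generated_transition\<close>,
  \<open>octagon_coded_gen0\<close>). So all generated words are coded by orbits with heights of the regular
  octagon. Such an orbit is turned back into a trajectory (\<open>octagon_coded_realizable\<close>), and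
  the symmetries of the octagon, which act on labels by the permutations \<open>\<pi>\<^sub>i\<close>, reach the other
  directions (\<open>realizable_perm\<close>).\<close>

section \<open>Partial sums and strictly increasing sequences over the integers\<close>

definition cumulative :: "(int \<Rightarrow> 'a::ab_group_add) \<Rightarrow> int \<Rightarrow> 'a" where
  "cumulative f n = (if 0 \<le> n then \<Sum>i\<in>{0..<n}. f i else - (\<Sum>i\<in>{n..<0}. f i))"

lemma cumulative_0 [simp]: "cumulative f 0 = 0"
  by (simp add: cumulative_def)

lemma cumulative_step: "cumulative f (n + 1) = cumulative f n + f n"
proof (cases "0 \<le> n")
  case True
  then have "{0..<n + 1} = insert n {0..<n}" by auto
  then show ?thesis using True by (simp add: cumulative_def add.commute)
next
  case False
  then have "{n..<0} = insert n {n + 1..<0}" by auto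
  then show ?thesis using False by (auto simp: cumulative_def)
qed

lemma cumulative_periodic:
  assumes "\<And>n. f (n + N) = f n"
  shows "cumulative f (n + N) = cumulative f n + cumulative f N"
proof (induction n rule: int_induct[where k = 0])
  case (step1 i)
  have "i + 1 + N = (i + N) + 1" by simp
  then show ?case using step1 assms[of i] by (simp only: cumulative_step) simp
next
  case (step2 i)
  have "cumulative f (i + N) = cumulative f (i - 1 + N) + f (i - 1)"
    using cumulative_step[of f "i - 1 + N"] assms[of "i - 1"] by simp
  moreover have "cumulative f i = cumulative f (i - 1) + f (i - 1)"
    using cumulative_step[of f "i - 1"] by simp
  ultimately show ?case using step2 by simp
qed simp

lemma strict_mono_int_step:
  fixes t :: "int \<Rightarrow> 'a::order"
  assumes step: "\<And>n. t n < t (n + 1)"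
  shows "strict_mono t"
proof (rule strict_monoI)
  fix x y :: int assume "x < y"
  then show "t x < t y"
  proof (induction y rule: int_gr_induct)
    case base then show ?case by (rule step)
  next
    case (step i) then show ?case using assms[of i] by (blast intro: less_trans)
  qed
qed

lemma strict_mono_intD: "strict_mono t \<Longrightarrow> t n < t (n + 1)" for t :: "int \<Rightarrow> 'a::order"
  by (simp add: strict_mono_def)

lemma cumulative_strict_mono:
  fixes f :: "int \<Rightarrow> 'a::ordered_ab_group_add"
  assumes "\<And>n. 0 < f n"
  shows "strict_mono (cumulative f)"
  by (rule strict_mono_int_step) (simp add: cumulative_step assms)

lemma cumulative_lower:
  fixes f :: "int \<Rightarrow> 'a::linordered_idom"
  assumes "\<And>n. e \<le> f n"
  shows "0 \<le> n \<Longrightarrow> of_int n * e \<le> cumulative f n"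
proof (induction n rule: int_ge_induct)
  case (step i)
  then show ?case using assms[of i] cumulative_step[of f i] by (simp add: distrib_right)
qed simp

lemma cumulative_upper:
  fixes f :: "int \<Rightarrow> 'a::linordered_idom"
  assumes "\<And>n. e \<le> f n"
  shows "n \<le> 0 \<Longrightarrow> cumulative f n \<le> of_int n * e"
proof (induction n rule: int_le_induct)
  case (step i)
  have "cumulative f i = cumulative f (i - 1) + f (i - 1)"
    using cumulative_step[of f "i - 1"] by simp
  then show ?case using step assms[of "i - 1"] by (simp add: algebra_simps)
qed simp

lemma strict_mono_int_locate:
  fixes t :: "int \<Rightarrow> 'a::linorder"
  assumes t: "strict_mono t" and "t n0 \<le> r" and "r < t n1"
  shows "\<exists>!n. t n \<le> r \<and> r < t (n + 1)"
proof -
  have "n0 < n1" using assms strict_mono_less[OF t, of n0 n1] by (meson le_less_trans)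
  then have ex: "\<exists>k. r < t (n0 + int k)"
    using assms(3) by (intro exI[of _ "nat (n1 - n0)"]) simp
  define k where "k = (LEAST k. r < t (n0 + int k))"
  have k: "r < t (n0 + int k)" unfolding k_def using ex by (rule LeastI_ex)
  then have "k \<noteq> 0" using assms(2) by (intro notI) auto
  then obtain i where i: "k = Suc i" by (cases k) auto
  have "\<not> r < t (n0 + int i)" using not_less_Least[of i "\<lambda>k. r < t (n0 + int k)"] i
    unfolding k_def by simp
  then have "t (n0 + int i) \<le> r \<and> r < t (n0 + int i + 1)"
    using k i by (simp add: algebra_simps)
  moreover have "x = y" if "t x \<le> r \<and> r < t (x + 1)" "t y \<le> r \<and> r < t (y + 1)" for x y
  proof -
    have "x < y + 1" "y < x + 1" using that strict_mono_less[OF t] by (meson le_less_trans)+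
    then show ?thesis by simp
  qed
  ultimately show ?thesis by blast
qed

lemma strict_mono_int_int_locate:
  fixes t :: "int \<Rightarrow> int"
  assumes t: "strict_mono t"
  shows "\<exists>!n. t n \<le> r \<and> r < t (n + 1)"
proof -
  have t1: "1 \<le> t (n + 1) - t n" for n using strict_mono_intD[OF t, of n] by simp
  have tc: "cumulative (\<lambda>n. t (n + 1) - t n) n = t n - t 0" for n
  proof (induction n rule: int_induct[where k = 0])
    case (step2 i)
    then show ?case using cumulative_step[of "\<lambda>n. t (n + 1) - t n" "i - 1"] by simp
  qed (simp_all add: cumulative_step)
  define n where "n = \<bar>r - t 0\<bar> + 1"
  have "0 \<le> n" "\<bar>r - t 0\<bar> < n" by (simp_all add: n_def)
  then have "t (- n) \<le> r" "r < t n"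
    using cumulative_upper[of 1 "\<lambda>n. t (n + 1) - t n" "- n"]
      cumulative_lower[of 1 "\<lambda>n. t (n + 1) - t n" n] t1
    unfolding tc by auto
  then show ?thesis by (rule strict_mono_int_locate[OF t])
qed

section \<open>Bi-infinite concatenation of blocks\<close>

lemma block_start_cumulative: "block_start b = cumulative (\<lambda>n. int (length (b n)))"
  by (simp add: fun_eq_iff block_start_def cumulative_def)

lemma block_start_step: "block_start b (n + 1) = block_start b n + int (length (b n))"
  by (simp add: block_start_cumulative cumulative_step)

context
  fixes b :: "int \<Rightarrow> 'a list"
  assumes nonempty: "\<And>n. b n \<noteq> []"
begin

lemma block_start_strict_mono: "strict_mono (block_start b)"
  unfolding block_start_cumulative by (rule cumulative_strict_mono) (simp add: nonempty)

lemma bi_concat_block: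
  assumes "i < length (b n)"
  shows "bi_concat b (block_start b n + int i) = b n ! i"
proof -
  have "(THE k. block_start b k \<le> block_start b n + int i \<and> block_start b n + int i < block_start b (k + 1)) = n"
    using assms by (intro the1_equality strict_mono_int_int_locate[OF block_start_strict_mono])
      (simp add: block_start_step)
  then show ?thesis by (simp add: bi_concat_def Let_def)
qed

lemma bi_concat_cases:
  obtains n i where "m = block_start b n + int i" "i < length (b n)"
proof -
  obtain n where n: "block_start b n \<le> m" "m < block_start b (n + 1)"
    using strict_mono_int_int_locate[OF block_start_strict_mono] by blast
  show thesis by (rule that[of n "nat (m - block_start b n)"]) (use n in \<open>auto simp: block_start_step\<close>)
qed

lemma bi_concat_all:
  assumes "\<And>n x. x \<in> set (b n) \<Longrightarrow> P x"
  shows "P (bi_concat b m)"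
  by (rule bi_concat_cases[of m]) (metis assms bi_concat_block nth_mem)

lemma bi_concat_successive:
  assumes "\<And>n. successively R (b n @ [hd (b (n + 1))])"
  shows "R (bi_concat b m) (bi_concat b (m + 1))"
proof -
  obtain n i where m: "m = block_start b n + int i" and i: "i < length (b n)"
    by (rule bi_concat_cases)
  let ?xs = "b n @ [hd (b (n + 1))]"
  have R: "R (?xs ! i) (?xs ! Suc i)"
    using assms[of n] i by (simp add: successively_conv_nth)
  have "bi_concat b (m + 1) = ?xs ! Suc i"
  proof (cases "Suc i < length (b n)")
    case True
    then show ?thesis using bi_concat_block[OF True] by (simp add: m nth_append add_ac)
  next
    case False
    then have "m + 1 = block_start b (n + 1) + int 0" using i m by (simp add: block_start_step)
    then show ?thesis
      using False i nonempty[of "n + 1"] bi_concat_block[of 0 "n + 1"]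
      by (simp add: nth_append hd_conv_nth less_Suc_eq_le)
  qed
  then show ?thesis using R i by (simp add: m bi_concat_block nth_append)
qed

lemma bi_concat_periodic:
  assumes "\<And>n. b (n + N) = b n"
  shows "bi_concat b (m + block_start b N) = bi_concat b m"
proof -
  obtain n i where m: "m = block_start b n + int i" and i: "i < length (b n)"
    by (rule bi_concat_cases)
  have "block_start b (n + N) = block_start b n + block_start b N"
    unfolding block_start_cumulative by (rule cumulative_periodic) (simp add: assms)
  then have "m + block_start b N = block_start b (n + N) + int i" using m by simp
  then show ?thesis using i bi_concat_block[of i "n + N"] bi_concat_block[of i n] assms[of n] m
    by metis
qed

end

lemma bi_concat_map:
  assumes "\<And>n. b n \<noteq> []"
  shows "bi_concat (\<lambda>n. map f (b n)) = f \<circ> bi_concat b"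
proof
  fix m
  obtain n i where m: "m = block_start b n + int i" and i: "i < length (b n)"
    using assms by (rule bi_concat_cases)
  have "block_start (\<lambda>n. map f (b n)) = block_start b"
    by (simp add: block_start_cumulative)
  then show "bi_concat (\<lambda>n. map f (b n)) m = (f \<circ> bi_concat b) m"
    using i assms bi_concat_block[of b i n] bi_concat_block[of "\<lambda>n. map f (b n)" i n]
    by (simp add: m)
qed

section \<open>Words without sandwiched letters\<close>

lemma less_8_cases: "i \<le> (7::nat) \<Longrightarrow> i \<in> {0, 1, 2, 3, 4, 5, 6, 7}"
  by auto

lemma perm_table:
  "perm 0 = id"
  "perm (Suc 0) A = D" "perm (Suc 0) B = C" "perm (Suc 0) C = B" "perm (Suc 0) D = A"
  "perm 2 A = B" "perm 2 B = C" "perm 2 C = D" "perm 2 D = A"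
  "perm 3 A = C" "perm 3 B = B" "perm 3 C = A" "perm 3 D = D"
  "perm 4 A = C" "perm 4 B = D" "perm 4 C = A" "perm 4 D = B"
  "perm 5 A = B" "perm 5 B = A" "perm 5 C = D" "perm 5 D = C"
  "perm 6 A = D" "perm 6 B = A" "perm 6 C = B" "perm 6 D = C"
  "perm 7 A = A" "perm 7 B = D" "perm 7 C = C" "perm 7 D = B"
  by (simp_all add: perm_def transpose_def)

text \<open>The longest word admissible in diagram 0 in which no inner letter is sandwiched. Every other such
  word is a factor of it.\<close>

definition chain :: "letter list" where
  "chain = [A, D, B, C, C, B, D, A]"

text \<open>The index at which the transition from \<open>x\<close> to \<open>y\<close> occurs in \<^const>\<open>chain\<close>; each transition of
  diagram 0 occurs there exactly once. The value 7 stands for a pair that is not a transition.\<close>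

definition link :: "letter \<Rightarrow> letter \<Rightarrow> nat" where
  "link x y = (case (x, y) of (A, D) \<Rightarrow> 0 | (D, B) \<Rightarrow> 1 | (B, C) \<Rightarrow> 2 | (C, C) \<Rightarrow> 3
    | (C, B) \<Rightarrow> 4 | (B, D) \<Rightarrow> 5 | (D, A) \<Rightarrow> 6 | _ \<Rightarrow> 7)"

text \<open>The index in \<^const>\<open>chain\<close> at which \<open>x\<close> is followed by its sandwiching letter. As the chain is a
  palindrome, \<open>7 - depth k x\<close> is the index at which \<open>x\<close> is preceded by that letter.\<close>

definition depth :: "nat \<Rightarrow> letter \<Rightarrow> nat" where
  "depth k x = link x (sandwiching_letter k x)"

text \<open>Without backtracking a path in diagram 0 has no choice: it moves one step down the chain.\<close>

lemma link_step: "trans0 x y \<Longrightarrow> trans0 y z \<Longrightarrow> x \<noteq> z \<Longrightarrow> link y z = Suc (link x y)"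
  by (cases x; cases y; cases z) (simp_all add: trans0_def link_def)

lemma chain_link:
  "trans0 x y \<Longrightarrow> link x y \<le> 6 \<and> chain ! link x y = x \<and> chain ! Suc (link x y) = y"
  by (cases x; cases y) (simp_all add: trans0_def link_def chain_def numeral_eq_Suc)

lemma link_reverse: "trans0 x y \<Longrightarrow> link y x = 6 - link x y"
  by (cases x; cases y) (simp_all add: trans0_def link_def)

lemma trans0_sym: "trans0 x y \<Longrightarrow> trans0 y x"
  by (auto simp: trans0_def)

lemma unsandwiched_walk:
  assumes "successively trans0 xs" "2 \<le> length xs"
    and "\<And>i. 0 < i \<Longrightarrow> i < length xs - 1 \<Longrightarrow> xs ! (i - 1) \<noteq> xs ! (i + 1)"
  shows "link (xs ! 0) (xs ! 1) + length xs \<le> 8"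
    and "link (xs ! (length xs - 2)) (xs ! (length xs - 1)) = link (xs ! 0) (xs ! 1) + (length xs - 2)"
    and "\<And>i. i < length xs \<Longrightarrow> xs ! i = chain ! (link (xs ! 0) (xs ! 1) + i)"
proof -
  let ?p = "link (xs ! 0) (xs ! 1)"
  have t: "trans0 (xs ! i) (xs ! Suc i)" if "Suc i < length xs" for i
    using assms(1) that by (simp add: successively_conv_nth)
  have link: "link (xs ! i) (xs ! Suc i) = ?p + i" if "Suc i < length xs" for i
    using that
  proof (induction i)
    case (Suc i)
    then show ?case using link_step[OF t t, of i] assms(3)[of "Suc i"] by simp
  qed simp
  let ?n = "length xs - 2"
  have last: "Suc ?n < length xs" "Suc ?n = length xs - 1" using assms(2) by auto
  show "link (xs ! ?n) (xs ! (length xs - 1)) = ?p + ?n"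
    using link[OF last(1)] last(2) by simp
  have "link (xs ! ?n) (xs ! Suc ?n) \<le> 6" using chain_link[OF t[OF last(1)]] by blast
  then show "?p + length xs \<le> 8"
    using link[OF last(1)] assms(2) by linarith
  show "xs ! i = chain ! (?p + i)" if "i < length xs" for i
  proof (cases i)
    case 0
    then show ?thesis using chain_link[OF t[of 0]] assms(2) by simp
  next
    case (Suc j)
    then show ?thesis using chain_link[OF t[of j]] link[of j] that by simp
  qed
qed

lemma sandwiching_letter_eq:
  assumes "k \<le> 7" "(y, x) \<in> sandwich_class (k div 2)"
  shows "sandwiching_letter k x = y"
  unfolding sandwiching_letter_def
proof (rule the_equality)
  fix y' assume *: "(y', x) \<in> sandwich_class (k div 2)"
  have "k div 2 \<in> {0, 1, 2, 3}" using assms(1) by auto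
  then show "y' = y"
    using * assms(2) by (elim insertE emptyE) (auto simp: sandwich_class_def numeral_eq_Suc)
qed (rule assms)

lemma sandwiching_letter_table:
  assumes "k \<le> 7"
  shows "sandwiching_letter k A = D"
    and "sandwiching_letter k B = (if k div 2 = 3 then D else C)"
    and "sandwiching_letter k C = (if k div 2 \<le> 1 then B else C)"
    and "sandwiching_letter k D = (if k div 2 = 0 then A else B)"
proof -
  have "k div 2 \<in> {0, 1, 2, 3}" using assms(1) by auto
  then have "(D, A) \<in> sandwich_class (k div 2)"
    "((if k div 2 = 3 then D else C), B) \<in> sandwich_class (k div 2)"
    "((if k div 2 \<le> 1 then B else C), C) \<in> sandwich_class (k div 2)"
    "((if k div 2 = 0 then A else B), D) \<in> sandwich_class (k div 2)"
    by (elim insertE emptyE; simp add: sandwich_class_def numeral_eq_Suc)+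
  then show "sandwiching_letter k A = D"
    and "sandwiching_letter k B = (if k div 2 = 3 then D else C)"
    and "sandwiching_letter k C = (if k div 2 \<le> 1 then B else C)"
    and "sandwiching_letter k D = (if k div 2 = 0 then A else B)"
    using sandwiching_letter_eq[OF assms] by blast+
qed

lemma depth_table:
  assumes "k \<le> 7"
  shows "depth k A = 0"
    and "depth k B = (if k div 2 = 3 then 5 else 2)"
    and "depth k C = (if k div 2 \<le> 1 then 4 else 3)"
    and "depth k D = (if k div 2 = 0 then 6 else 1)"
  by (simp_all add: depth_def sandwiching_letter_table[OF assms] link_def)

lemma trans0_sandwiching_letter: "k \<le> 7 \<Longrightarrow> trans0 x (sandwiching_letter k x)"
  by (cases x) (simp_all add: sandwiching_letter_table trans0_def)

text \<open>The word from \<open>x\<close> to \<open>y\<close> starts with the transition from \<open>x\<close> to its sandwiching letter, ends with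
  the transition from the sandwiching letter of \<open>y\<close> to \<open>y\<close>, and walks down the chain in between. Both
  ends being given, the word is determined, and the end must not come before the start.\<close>

lemma interpolates_unique:
  assumes k: "k \<le> 7" and "interpolates k x y u"
  shows "depth k x + depth k y \<le> 6"
    and "u = map ((!) chain) [Suc (depth k x)..<7 - depth k y]"
proof -
  define xs where "xs = x # u @ [y]"
  have len: "2 \<le> length xs" "length xs = length u + 2" by (simp_all add: xs_def)
  have suc: "successively trans0 xs"
    and second: "xs ! 1 = sandwiching_letter k x"
    and penult: "xs ! (length xs - 2) = sandwiching_letter k y"
    and uns: "\<And>i. 0 < i \<Longrightarrow> i < length xs - 1 \<Longrightarrow> xs ! (i - 1) \<noteq> xs ! (i + 1)"
    using assms(2) unfolding interpolates_def Let_def xs_def[symmetric] by blast+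
  have "xs ! 0 = x" "xs ! (length xs - 1) = y" by (simp_all add: xs_def nth_append)
  then have p: "link (xs ! 0) (xs ! 1) = depth k x"
    and q: "link (xs ! (length xs - 2)) (xs ! (length xs - 1)) = 6 - depth k y"
    using second penult link_reverse[OF trans0_sandwiching_letter[OF k, of y]]
    by (simp_all add: depth_def)
  note walk = unsandwiched_walk[OF suc len(1) uns, unfolded p q]
  have "depth k y \<le> 6"
    using chain_link[OF trans0_sandwiching_letter[OF k, of y]] by (simp add: depth_def)
  then have l: "depth k x + length u = 6 - depth k y" "depth k y \<le> 6"
    using walk(2) len(2) by simp_all
  then show "depth k x + depth k y \<le> 6" by simp
  have "u ! i = chain ! (Suc (depth k x) + i)" if "i < length u" for i
    using walk(3)[of "Suc i"] that len by (simp add: xs_def nth_append)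
  then show "u = map ((!) chain) [Suc (depth k x)..<7 - depth k y]"
    using l by (intro nth_equalityI) auto
qed

lemma interpolating_word_eq:
  assumes "k \<le> 7" "interpolates k x y u"
  shows "interpolating_word k x y = u"
  unfolding interpolating_word_def
  using assms interpolates_unique(2)[OF assms(1)] by (intro the_equality) metis+

lemma depth_bound: "k \<le> 7 \<Longrightarrow> depth k x \<le> 6"
  using chain_link[OF trans0_sandwiching_letter] by (simp add: depth_def)

lemma chain_depth: "k \<le> 7 \<Longrightarrow> chain ! depth k x = x"
  "k \<le> 7 \<Longrightarrow> chain ! (7 - depth k x) = x"
  "k \<le> 7 \<Longrightarrow> chain ! Suc (depth k x) = sandwiching_letter k x"
  "k \<le> 7 \<Longrightarrow> chain ! (6 - depth k x) = sandwiching_letter k x"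
  by (cases x; force simp: depth_table sandwiching_letter_table chain_def numeral_eq_Suc)+

lemma interpolates_chain:
  assumes k: "k \<le> 7" and le: "depth k x + depth k y \<le> 6"
  shows "interpolates k x y (map ((!) chain) [Suc (depth k x)..<7 - depth k y])"
proof -
  define s where "s = depth k x"
  define n where "n = 8 - depth k x - depth k y"
  define xs where "xs = map ((!) chain) [s..<s + n]"
  have n: "2 \<le> n" "s + n = 8 - depth k y" "s + n \<le> 8" "depth k y \<le> 6" using le by (auto simp: n_def s_def)
  have "s + n = Suc (7 - depth k y)" "Suc s \<le> 7 - depth k y" using n by auto
  then have "[s..<s + n] = s # [Suc s..<7 - depth k y] @ [7 - depth k y]"
    using upt_conv_Cons[of s "s + n"] upt_Suc_append[of "Suc s" "7 - depth k y"] by simp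
  then have xs: "x # map ((!) chain) [Suc (depth k x)..<7 - depth k y] @ [y] = xs"
    using chain_depth[OF k] by (simp add: xs_def s_def)
  have nth: "xs ! i = chain ! (s + i)" if "i < n" for i using that by (simp add: xs_def)
  have len: "length xs = n" by (simp add: xs_def)
  have chain_trans: "\<forall>i<7. trans0 (chain ! i) (chain ! Suc i)"
    and chain_uns: "\<forall>i<6. chain ! i \<noteq> chain ! Suc (Suc i)"
    by (simp_all add: chain_def trans0_def All_less_Suc numeral_eq_Suc)
  have "successively trans0 xs"
    using n chain_trans by (auto simp: successively_conv_nth len nth)
  moreover have "xs ! 1 = sandwiching_letter k x"
    using n nth[of 1] chain_depth(3)[OF k, of x] by (simp add: s_def)
  moreover have "xs ! (length xs - 2) = sandwiching_letter k y"
  proof -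
    have "s + (n - 2) = 6 - depth k y" using n by simp
    then show ?thesis using n nth[of "n - 2"] chain_depth(4)[OF k, of y] by (simp add: len)
  qed
  moreover have "xs ! (i - 1) \<noteq> xs ! (i + 1)" if "0 < i" "i < length xs - 1" for i
  proof -
    have "Suc (Suc (s + (i - 1))) = s + (i + 1)" "s + (i - 1) < 6" "i - 1 < n" "i + 1 < n"
      using that n by (auto simp: len)
    then show ?thesis using chain_uns nth[of "i - 1"] nth[of "i + 1"] by metis
  qed
  ultimately show ?thesis unfolding interpolates_def Let_def xs by blast
qed

section \<open>Windows of coherent words\<close>

text \<open>Expansion is local: if \<open>z\<close> agrees, up to a shift, with the letters \<open>v (e a), \<dots>, v (e b)\<close>, and \<open>v\<close>
  is the concatenation of the expanded blocks there, then the expansion of \<open>z\<close> agrees with \<open>v\<close> from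
  the position of the first of these letters to that of the last.\<close>

lemma gen0_window:
  fixes e :: "int \<Rightarrow> int"
  assumes e: "strict_mono e" and ab: "a \<le> b"
    and blocks: "\<And>n. a \<le> n \<Longrightarrow> n < b \<Longrightarrow>
      map v [e n..e (n + 1) - 1] = v (e n) # interpolating_word k (v (e n)) (v (e (n + 1)))"
    and z: "\<And>n. a \<le> n \<Longrightarrow> n \<le> b \<Longrightarrow> z (n + d) = v (e n)"
  shows "\<exists>c. \<forall>i\<in>{e a..e b}. gen0 k z (i + c) = v i"
proof -
  define B where "B n = z n # interpolating_word k (z n) (z (n + 1))" for n
  have B: "B (n + d) = map v [e n..e (n + 1) - 1]" if "a \<le> n" "n < b" for n
    using blocks[OF that] z[of n] z[of "n + 1"] that by (simp add: B_def add_ac)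
  have ne: "B n \<noteq> []" for n by (simp add: B_def)
  have e1: "e n < e (n + 1)" for n using e by (rule strict_mono_intD)
  have start: "n \<le> b \<Longrightarrow> block_start B (n + d) = block_start B (a + d) + (e n - e a)" if "a \<le> n" for n
    using that
  proof (induction n rule: int_ge_induct)
    case (step i)
    then show ?case
      using block_start_step[of B "i + d"] B[of i] e1[of i] by (simp add: add_ac)
  qed simp
  have "gen0 k z (i + (block_start B (a + d) - e a)) = v i" if i: "i \<in> {e a..e b}" for i
  proof -
    have gen: "gen0 k z = bi_concat B" unfolding gen0_def B_def ..
    show ?thesis
    proof (cases "i = e b")
      case True
      have "i + (block_start B (a + d) - e a) = block_start B (b + d) + int 0"
        using start[of b] ab True by simp
      then show ?thesis
        using bi_concat_block[of B 0 "b + d", OF ne] z[of b] ab by (simp add: gen True B_def)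
    next
      case False
      obtain n where n: "e n \<le> i" "i < e (n + 1)" using strict_mono_int_int_locate[OF e] by blast
      have "e a < e (n + 1)" "e n < e b" using i n False by auto
      then have "a < n + 1" "n < b" using strict_mono_less[OF e] by auto
      then have an: "a \<le> n" "n < b" by auto
      have "i + (block_start B (a + d) - e a) = block_start B (n + d) + int (nat (i - e n))"
        using start[of n] an n by simp
      moreover have "nat (i - e n) < length (B (n + d))" using n by (simp add: B[OF an])
      ultimately have "gen0 k z (i + (block_start B (a + d) - e a)) = B (n + d) ! nat (i - e n)"
        using bi_concat_block[of B "nat (i - e n)" "n + d", OF ne] by (simp add: gen)
      also have "\<dots> = v i" using n by (simp add: B[OF an])
      finally show ?thesis .
    qed
  qed
  then show ?thesis by blast
qed

text \<open>The generation operators are iterated from the inside, the derivations of a coherent word from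
  the outside. The next two equations peel off the first index of \<open>s\<close> from both, as the induction on
  windows requires.\<close>

lemma gen_iter_Suc_left: "gen_iter s (Suc k) z = gen (s 0) (s 1) (gen_iter (s \<circ> Suc) k z)"
proof (induction k arbitrary: z)
  case (Suc k)
  have "gen_iter s (Suc (Suc k)) z = gen_iter s (Suc k) (gen (s (Suc k)) (s (Suc (Suc k))) z)" by simp
  also have "\<dots> = gen (s 0) (s 1) (gen_iter (s \<circ> Suc) k (gen (s (Suc k)) (s (Suc (Suc k))) z))"
    by (rule Suc)
  also have "\<dots> = gen (s 0) (s 1) (gen_iter (s \<circ> Suc) (Suc k) z)" by simp
  finally show ?case .
qed simp

lemma coherence_word_Suc_left:
  "coherence_word s w (Suc k) = coherence_word (s \<circ> Suc) (derived (perm (s 0) \<circ> w)) k"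
  by (induction k) (simp_all add: comp_def)

lemma derived_enumeration:
  assumes "admissible v"
  obtains e where "strict_mono e" "range e = {n. sandwiched v n}" "derived v = v \<circ> e"
proof -
  define e :: "int \<Rightarrow> int" where "e = (SOME e. strict_mono e \<and> range e = {n. sandwiched v n})"
  have "strict_mono e \<and> range e = {n. sandwiched v n}"
    unfolding e_def using sandwiched_enumeration[OF assms] by (rule someI_ex)
  moreover have "derived v = v \<circ> e" by (simp only: derived_def e_def)
  ultimately show thesis using that by blast
qed

text \<open>Generation inverts derivation. The letters between two consecutive sandwiched positions \<open>e n\<close> and
  \<open>e (n + 1)\<close> are not sandwiched, and the sandwich class fixes the letters next to the two
  positions; so they satisfy the conditions that characterize the interpolating word.\<close>

lemma desubstitution:
  fixes e :: "int \<Rightarrow> int"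
  assumes k: "k \<le> 7" and v: "\<And>n. trans0 (v n) (v (n + 1))"
    and sandwich: "\<And>n. sandwiched v n \<Longrightarrow> (v (n - 1), v n) \<in> sandwich_class (k div 2)"
    and e: "strict_mono e" "range e = {n. sandwiched v n}"
  shows "map v [e n..e (n + 1) - 1] = v (e n) # interpolating_word k (v (e n)) (v (e (n + 1)))"
proof -
  have e1: "e n < e (n + 1)" using e(1) by (rule strict_mono_intD)
  define u where "u = map v [e n + 1..e (n + 1) - 1]"
  have "[e n..e (n + 1)] = e n # [e n + 1..e (n + 1) - 1] @ [e (n + 1)]"
    using e1 by (simp add: upto_rec1[of "e n"] upto_rec2[of "e n + 1"])
  then have xs: "v (e n) # u @ [v (e (n + 1))] = map v [e n..e (n + 1)]" by (simp add: u_def)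
  have nth: "map v [e n..e (n + 1)] ! i = v (e n + int i)" if "int i \<le> e (n + 1) - e n" for i
    using that by simp
  have len: "int (length (map v [e n..e (n + 1)])) = e (n + 1) - e n + 1" using e1 by simp
  have sand: "v (e m + 1) = v (e m - 1)" "sandwiching_letter k (v (e m)) = v (e m - 1)" for m
  proof -
    have "sandwiched v (e m)" using e(2) by blast
    then show "v (e m + 1) = v (e m - 1)" "sandwiching_letter k (v (e m)) = v (e m - 1)"
      using sandwich sandwiching_letter_eq[OF k] by (auto simp: sandwiched_def)
  qed
  have "interpolates k (v (e n)) (v (e (n + 1))) u"
    unfolding interpolates_def Let_def xs
  proof (intro conjI allI impI)
    show "successively trans0 (map v [e n..e (n + 1)])"
      using v by (auto simp: successively_conv_nth add.assoc[symmetric] add.commute[of 1])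
    show "map v [e n..e (n + 1)] ! 1 = sandwiching_letter k (v (e n))"
      using nth[of 1] e1 sand[of n] by simp
    show "map v [e n..e (n + 1)] ! (length (map v [e n..e (n + 1)]) - 2) = sandwiching_letter k (v (e (n + 1)))"
      using nth[of "nat (e (n + 1) - e n - 1)"] e1 sand[of "n + 1"] by (simp add: nat_diff_distrib')
    fix i assume i: "0 < i \<and> i < length (map v [e n..e (n + 1)]) - 1"
    then have il: "int i < e (n + 1) - e n" "0 < i" by auto
    have "e n + int i \<notin> range e"
    proof
      assume "e n + int i \<in> range e"
      then obtain m where "e m = e n + int i" by (metis rangeE)
      then have "e n < e m" "e m < e (n + 1)" using il by auto
      then show False using strict_mono_less[OF e(1)] by simp
    qed
    then have "v (e n + int i - 1) \<noteq> v (e n + int i + 1)"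
      using e(2) by (simp add: sandwiched_def)
    then show "map v [e n..e (n + 1)] ! (i - 1) \<noteq> map v [e n..e (n + 1)] ! (i + 1)"
      using nth[of "i - 1"] nth[of "i + 1"] il by (simp add: of_nat_diff algebra_simps)
  qed
  then have "interpolating_word k (v (e n)) (v (e (n + 1))) = u" by (rule interpolating_word_eq[OF k])
  moreover have "map v [e n..e (n + 1) - 1] = v (e n) # u"
    using e1 by (simp add: u_def upto_rec1[of "e n"])
  ultimately show ?thesis by simp
qed

text \<open>Only the inner positions of a window shrink under derivation, since both ends must stay covered:
  the window \<open>[a, b]\<close> of the derived sequence is the smallest one whose expansion covers \<open>[m, l]\<close>,
  and its inner positions are exactly the sandwiched inner positions of \<open>[m, l]\<close>. Thus it is
  shorter as soon as some inner position is not sandwiched.\<close>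

lemma coherent_window:
  assumes "\<And>k. s k \<le> 7" "\<And>k. coherent (coherence_word s w k) (s k) (s (Suc k))" "m < l"
  shows "\<exists>k. \<exists>z\<in>periodic_words (s k). \<exists>d. \<forall>i\<in>{m..l}. gen_iter s k z (i + d) = w i"
  using assms
proof (induction "nat (l - m)" arbitrary: s w m l rule: less_induct)
  case less
  define v where "v = perm (s 0) \<circ> w"
  have inj: "inj (perm (s 0))" using bij_perm[OF less.prems(1)] by (rule bij_is_inj)
  have "coherent w (s 0) (s 1)" using less.prems(2)[of 0] by simp
  then have adm: "admissible_in (s 0) w" and s1: "s 1 \<in> {1..7}"
    and sandwich: "\<And>n. sandwiched v n \<Longrightarrow> (v (n - 1), v n) \<in> sandwich_class (s 1 div 2)"
    unfolding coherent_def Let_def v_def[symmetric] by blast+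
  have v: "trans0 (v n) (v (n + 1))" for n using adm by (simp add: admissible_in_def v_def)
  show ?case
  proof (cases "\<forall>i. m < i \<and> i < l \<longrightarrow> sandwiched v i")
    case True
    then have period: "w (i - 1) = w (i + 1)" if "m < i" "i < l" for i
      using that inj by (auto simp: sandwiched_def v_def inj_eq)
    \<comment> \<open>All inner letters being sandwiched, the window alternates between its first two letters.\<close>
    define z where "z n = (if even (n - m) then w m else w (m + 1))" for n
    have "w i = z i \<and> (i < l \<longrightarrow> w (i + 1) = z (i + 1))" if "m \<le> i" "i \<le> l" for i
      using that
    proof (induction i rule: int_ge_induct)
      case (step i)
      then show ?case using period[of "i + 1"] by (auto simp: z_def)
    qed (simp add: z_def)
    moreover have "z \<in> periodic_words (s 0)"
    proof -
      have t: "trans0 (v m) (v (m + 1))" using v .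
      have "admissible_in (s 0) z"
        using t trans0_sym[OF t] by (auto simp: admissible_in_def z_def v_def)
      moreover have "z (n + 2) = z n" for n by (simp add: z_def)
      ultimately show ?thesis by (auto simp: periodic_words_def)
    qed
    ultimately show ?thesis by (intro exI[of _ 0] bexI[of _ z] exI[of _ 0]) auto
  next
    case False
    then obtain i0 where i0: "m < i0" "i0 < l" "\<not> sandwiched v i0" by blast
    have "admissible_in 0 v" using v by (simp add: admissible_in_def perm_table)
    then have "admissible v" by (auto simp: admissible_def)
    then obtain e where e: "strict_mono e" "range e = {n. sandwiched v n}" "derived v = v \<circ> e"
      by (rule derived_enumeration)
    \<comment> \<open>\<open>e a\<close> is the last sandwiched position up to \<open>m\<close>, and \<open>e b\<close> the first one from \<open>l\<close> on.\<close>
    obtain a where a: "e a \<le> m" "m < e (a + 1)" using strict_mono_int_int_locate[OF e(1)] by blast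
    obtain b' where b': "e b' \<le> l - 1" "l - 1 < e (b' + 1)"
      using strict_mono_int_int_locate[OF e(1)] by blast
    define b where "b = b' + 1"
    have "e a < e b" using a b' less.prems(3) by (simp add: b_def)
    then have ab: "a < b" using strict_mono_less[OF e(1)] by simp
    have "e ` {a<..<b} \<subseteq> {m<..<l} - {i0}"
    proof (clarsimp, intro conjI)
      fix n assume n: "a < n" "n < b"
      have "e (a + 1) \<le> e n" "e n \<le> e b'" using n strict_mono_less_eq[OF e(1)] by (auto simp: b_def)
      then show "m < e n" "e n < l" using a b' by auto
      show "e n \<noteq> i0" using i0(3) e(2) by auto
    qed
    then have "card (e ` {a<..<b}) \<le> card ({m<..<l} - {i0})" by (intro card_mono) auto
    moreover have "card (e ` {a<..<b}) = nat (b - a - 1)"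
      using card_image[OF inj_on_subset[OF strict_mono_imp_inj_on[OF e(1)]], of "{a<..<b}" UNIV]
      by (simp add: algebra_simps)
    moreover have "card ({m<..<l} - {i0}) = nat (l - m - 1) - 1" using i0 by simp
    ultimately have "nat (b - a) < nat (l - m)" using i0 ab by linarith
    moreover have "coherent (coherence_word (s \<circ> Suc) (derived v) k) ((s \<circ> Suc) k) ((s \<circ> Suc) (Suc k))" for k
      using less.prems(2)[of "Suc k"] unfolding coherence_word_Suc_left v_def o_apply .
    ultimately have "\<exists>k. \<exists>z\<in>periodic_words ((s \<circ> Suc) k).
        \<exists>d. \<forall>i\<in>{a..b}. gen_iter (s \<circ> Suc) k z (i + d) = derived v i"
      using less.prems(1) ab by (intro less.hyps[of b a "s \<circ> Suc" "derived v"]) simp_all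
    then obtain k z d where z: "z \<in> periodic_words (s (Suc k))"
      and d: "\<forall>i\<in>{a..b}. gen_iter (s \<circ> Suc) k z (i + d) = derived v i"
      unfolding o_apply by blast
    have s7: "s 1 \<le> 7" using s1 by simp
    obtain c where c: "\<forall>i\<in>{e a..e b}. gen0 (s 1) (gen_iter (s \<circ> Suc) k z) (i + c) = v i"
      using gen0_window[OF e(1) less_imp_le[OF ab] desubstitution[OF s7 v sandwich e(1,2)],
          of "gen_iter (s \<circ> Suc) k z" d] d e(3) by auto
    have "gen_iter s (Suc k) z (i + c) = w i" if "i \<in> {m..l}" for i
    proof -
      have "gen0 (s 1) (gen_iter (s \<circ> Suc) k z) (i + c) = perm (s 0) (w i)"
        using c that a b' by (simp add: b_def v_def)
      then show ?thesis
        unfolding gen_iter_Suc_left gen_def o_apply using inj by simp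
    qed
    then show ?thesis using z by blast
  qed
qed

section \<open>Trajectories as orbits of an interval exchange\<close>

text \<open>For a direction of angle \<open>\<theta>\<close> in \<open>[0, \<pi>/8]\<close> the sides labelled \<open>A\<close>, \<open>B\<close>, \<open>C\<close>, \<open>D\<close> have extents
  \<open>sin \<theta>\<close>, \<open>sin (\<theta> + \<pi>/4)\<close>, \<open>sin (\<theta> + \<pi>/2)\<close>, \<open>sin (\<theta> + 3\<pi>/4)\<close> across the direction. The functions
  \<open>h\<close> below are the positive multiples of these four values; \<open>h A \<le> h D\<close> says that \<open>\<theta> \<le> \<pi>/8\<close>. The
  bound \<open>\<theta> = 0\<close> is included, where the side \<open>A\<close> is parallel to the direction and has height 0.\<close>

definition octagon_heights :: "(letter \<Rightarrow> real) \<Rightarrow> bool" where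
  "octagon_heights h \<longleftrightarrow> 0 \<le> h A \<and> h A \<le> h D \<and> 0 < h C \<and>
     sqrt 2 * h B = h A + h C \<and> sqrt 2 * h D = h C - h A"

text \<open>The height, above the centre of the octagon, of the midpoint of the side through which the
  trajectory leaves. The four exit sides are stacked in the order \<open>D\<close>, \<open>C\<close>, \<open>B\<close>, \<open>A\<close> from below, and
  together they fill an interval symmetric about 0.\<close>

definition midheight :: "(letter \<Rightarrow> real) \<Rightarrow> letter \<Rightarrow> real" where
  "midheight h x = (case x of A \<Rightarrow> (h B + h C + h D) / 2 | B \<Rightarrow> (h C + h D - h A) / 2
     | C \<Rightarrow> (h D - h A - h B) / 2 | D \<Rightarrow> - (h A + h B + h C) / 2)"

text \<open>In a pair \<open>(x, \<xi>)\<close> the number \<open>\<xi>\<close> is the height of the crossing point above the midpoint of the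
  side \<open>x\<close>. Gluing opposite sides lowers the trajectory by twice the height of the midpoint, which
  gives the transition rule \<open>follows\<close>.\<close>

definition hits :: "(letter \<Rightarrow> real) \<Rightarrow> letter \<times> real \<Rightarrow> bool" where
  "hits h = (\<lambda>(x, \<xi>). 2 * \<bar>\<xi>\<bar> < h x)"

definition follows :: "(letter \<Rightarrow> real) \<Rightarrow> letter \<times> real \<Rightarrow> letter \<times> real \<Rightarrow> bool" where
  "follows h = (\<lambda>(x, \<xi>) (y, \<eta>). \<eta> = \<xi> - midheight h x - midheight h y)"

definition periodic_orbit :: "(letter \<Rightarrow> real) \<Rightarrow> (int \<Rightarrow> letter \<times> real) \<Rightarrow> bool" where
  "periodic_orbit h z \<longleftrightarrow> (\<forall>n. hits h (z n)) \<and> (\<forall>n. follows h (z n) (z (n + 1))) \<and>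
     (\<exists>N>0. \<forall>n. z (n + N) = z n)"

text \<open>These are the cutting sequences of periodic trajectories with direction in \<open>[0, \<pi>/8]\<close>, in a form
  that refers only to heights.\<close>

definition octagon_coded :: "(int \<Rightarrow> letter) \<Rightarrow> bool" where
  "octagon_coded w \<longleftrightarrow> (\<exists>h z. octagon_heights h \<and> periodic_orbit h z \<and> w = fst \<circ> z)"

text \<open>Multiplied by \<open>\<surd>2\<close>, the sum and the difference of the two defining equations express \<open>h A\<close> and \<open>h C\<close>
  by \<open>h B\<close> and \<open>h D\<close>; together with \<open>h A \<le> h D\<close> this orders all four heights.\<close>

lemma octagon_heights_ratios:
  assumes "octagon_heights h"
  shows "sqrt 2 * h A = h B - h D" "sqrt 2 * h C = h B + h D"
    "h D \<le> h B" "h B \<le> h C"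
proof -
  have s: "sqrt 2 * (sqrt 2 * x) = 2 * x" for x by simp
  have B: "sqrt 2 * h B = h A + h C" and D: "sqrt 2 * h D = h C - h A"
    and le: "0 \<le> h A" "h A \<le> h D" using assms by (auto simp: octagon_heights_def)
  show A': "sqrt 2 * h A = h B - h D" using arg_cong[OF B, of "(*) (sqrt 2)"] arg_cong[OF D, of "(*) (sqrt 2)"]
    unfolding s by (simp add: algebra_simps)
  show C': "sqrt 2 * h C = h B + h D" using arg_cong[OF B, of "(*) (sqrt 2)"] arg_cong[OF D, of "(*) (sqrt 2)"]
    unfolding s by (simp add: algebra_simps)
  have "0 \<le> sqrt 2 * h A" using le by simp
  then show "h D \<le> h B" using A' by simp
  show "h B \<le> h C"
  proof (rule ccontr)
    assume "\<not> h B \<le> h C"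
    then have "sqrt 2 * h C < sqrt 2 * h B" "h C < h B" by simp_all
    then show False using B C' le by linarith
  qed
qed

section \<open>Generation preserves coding by orbits\<close>

text \<open>Here \<open>h\<close> describes, after normalization by \<open>\<pi>\<^sub>j\<close>, a direction with angle between \<open>j \<pi>/8\<close> and
  \<open>(j + 1) \<pi>/8\<close>. The numbers \<open>a\<close>, \<open>b\<close>, \<open>c\<close>, \<open>d\<close> are the signed heights of the four sides with respect
  to that direction: for \<open>j \<ge> 2\<close> it leaves through the opposite copy of \<open>D\<close>, for \<open>j \<ge> 4\<close> also of
  \<open>C\<close>, for \<open>j \<ge> 6\<close> also of \<open>B\<close>. The shear with matrix \<open>(-1, 2 + 2\<surd>2; 0, 1)\<close> moves the
  direction into \<open>[0, \<pi>/8]\<close>. The values of the function are the heights of the sides with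
  respect to the image direction; the relation \<open>\<surd>2 a = b - d\<close> makes their coefficients integers.\<close>

definition generated_heights :: "nat \<Rightarrow> (letter \<Rightarrow> real) \<Rightarrow> letter \<Rightarrow> real" where
  "generated_heights j h =
    (let a = h (perm j A);
         b = (if 6 \<le> j then - h (perm j B) else h (perm j B));
         c = (if 4 \<le> j then - h (perm j C) else h (perm j C));
         d = (if 2 \<le> j then - h (perm j D) else h (perm j D))
     in (\<lambda>x. case x of A \<Rightarrow> a | B \<Rightarrow> 2 * a + b - 2 * d | C \<Rightarrow> 2 * a + 2 * b - c - 2 * d
       | D \<Rightarrow> 2 * a - d))"

lemma generated_heights_table:
  fixes h j
  defines "b \<equiv> (if 6 \<le> j then - h (perm j B) else h (perm j B))"
    and "c \<equiv> (if 4 \<le> j then - h (perm j C) else h (perm j C))"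
    and "d \<equiv> (if 2 \<le> j then - h (perm j D) else h (perm j D))"
  shows "generated_heights j h A = h (perm j A)"
    and "generated_heights j h B = 2 * h (perm j A) + b - 2 * d"
    and "generated_heights j h C = 2 * h (perm j A) + 2 * b - c - 2 * d"
    and "generated_heights j h D = 2 * h (perm j A) - d"
  by (simp_all only: generated_heights_def b_def c_def d_def Let_def letter.case)

lemma generated_heights_octagon:
  assumes j: "j \<in> {1..7}" and h: "octagon_heights h"
  shows "octagon_heights (generated_heights j h)"
proof -
  note ratios = octagon_heights_ratios[OF h]
  have h': "0 \<le> h A" "h A \<le> h D" "0 < h C" "sqrt 2 * h B = h A + h C" "sqrt 2 * h D = h C - h A"
    using h by (auto simp: octagon_heights_def)
  have j': "j \<in> {1, 2, 3, 4, 5, 6, 7}" using j by auto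
  define a b c d where "a = h (perm j A)"
    and "b = (if 6 \<le> j then - h (perm j B) else h (perm j B))"
    and "c = (if 4 \<le> j then - h (perm j C) else h (perm j C))"
    and "d = (if 2 \<le> j then - h (perm j D) else h (perm j D))"
  note abcd_def = this
  have ad: "0 \<le> a" "d \<le> a"
    using j' h' ratios unfolding abcd_def by (elim insertE emptyE; simp add: perm_table)+
  have pos: "0 < 2 * a + 2 * b - c - 2 * d"
    using j' h' ratios(3,4) unfolding abcd_def by (elim insertE emptyE; simp add: perm_table; linarith)
  have rot: "sqrt 2 * a = b - d" "sqrt 2 * b = a + c" "sqrt 2 * c = b + d" "sqrt 2 * d = c - a"
    using j' h'(4,5) ratios(1,2) unfolding abcd_def by (elim insertE emptyE; simp add: perm_table)+
  have g: "generated_heights j h A = a" "generated_heights j h B = 2 * a + b - 2 * d"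
    "generated_heights j h C = 2 * a + 2 * b - c - 2 * d" "generated_heights j h D = 2 * a - d"
    by (simp_all only: generated_heights_table abcd_def)
  have "sqrt 2 * (2 * a + b - 2 * d) = a + (2 * a + 2 * b - c - 2 * d)"
    using rot by (simp only: distrib_left right_diff_distrib mult.left_commute[of "sqrt 2" 2])
  moreover have "sqrt 2 * (2 * a - d) = (2 * a + 2 * b - c - 2 * d) - a"
    using rot by (simp only: distrib_left right_diff_distrib mult.left_commute[of "sqrt 2" 2])
  ultimately show ?thesis
    using ad pos unfolding octagon_heights_def g by simp
qed

text \<open>Unfold the octagons met by a line that crosses the sides of \<^const>\<open>chain\<close> in order, and let heights
  be measured from the centre of the octagon between the two sides \<open>C\<close>, the centre of symmetry of
  the picture. Then \<open>- chain_position h i\<close> is the height of the midpoint of the side with index \<open>i\<close>,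
  and a line at height \<open>\<zeta>\<close> has offset \<open>\<zeta> + chain_position h i\<close> on that side.\<close>

primrec chain_position :: "(letter \<Rightarrow> real) \<Rightarrow> nat \<Rightarrow> real" where
  "chain_position h 0 = midheight h A + 2 * (midheight h D + midheight h B + midheight h C)"
| "chain_position h (Suc i) =
    chain_position h i - midheight h (chain ! i) - midheight h (chain ! Suc i)"

text \<open>The shear reverses the orientation, and so does the isometry behind \<open>\<pi>\<^sub>j\<close> exactly when \<open>j\<close> is odd.
  Offsets are multiplied by the product of the two signs.\<close>

definition orientation :: "nat \<Rightarrow> real" where
  "orientation j = (if even j then - 1 else 1)"

lemma midheight_table:
  "2 * midheight h A = h B + h C + h D" "2 * midheight h B = h C + h D - h A"
  "2 * midheight h C = h D - h A - h B" "2 * midheight h D = - h A - h B - h C"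
  by (simp_all add: midheight_def)

lemma chain_table: "chain ! 0 = A" "chain ! Suc 0 = D" "chain ! 2 = B" "chain ! 3 = C"
  "chain ! 4 = C" "chain ! 5 = B" "chain ! 6 = D" "chain ! 7 = A"
  by (simp_all add: chain_def numeral_eq_Suc)

lemma chain_position_table:
  "2 * chain_position h 0 = 5 * h D + h C - 6 * h A - 3 * h B"
  "2 * chain_position h (Suc 0) = 4 * h D + h C - 5 * h A - 3 * h B"
  "2 * chain_position h 2 = 3 * h D + h C - 3 * h A - 2 * h B"
  "2 * chain_position h 3 = h D - h A - h B"
  "2 * chain_position h 4 = h A + h B - h D"
  "2 * chain_position h 5 = 3 * h A + 2 * h B - h C - 3 * h D"
  "2 * chain_position h 6 = 5 * h A + 3 * h B - h C - 4 * h D"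
  "2 * chain_position h 7 = 6 * h A + 3 * h B - h C - 5 * h D"
  using midheight_table[of h] by (simp_all add: numeral_eq_Suc chain_def)

declare chain_position.simps [simp del]

lemma chain_position_reverse:
  assumes "i \<le> 7"
  shows "chain_position h (7 - i) = - chain_position h i"
  using less_8_cases[OF assms] chain_position_table[of h] by (elim insertE emptyE) simp_all

text \<open>The identity that makes generation work: as seen from the centre of the chain, the midpoint of the
  side \<open>x\<close> next to its sandwiching letter lies as high, up to sign, as the midpoint of the side \<open>\<pi>\<^sub>j x\<close>
  lies in the original octagon. The step of the original orbit from \<open>x\<close> to \<open>y\<close> therefore becomes a
  straight line along the chain from index \<open>depth j x\<close> to index \<open>7 - depth j y\<close>.\<close>

lemma chain_position_depth:
  assumes "j \<in> {1..7}"
  shows "chain_position (generated_heights j h) (depth j x) = orientation j * midheight h (perm j x)"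
proof -
  have "j \<in> {1, 2, 3, 4, 5, 6, 7}" using assms by auto
  then have "2 * chain_position (generated_heights j h) (depth j x) = orientation j * (2 * midheight h (perm j x))"
    by (elim insertE emptyE; cases x)
      (simp_all add: depth_table chain_position_table midheight_table perm_table orientation_def
        generated_heights_table)
  then show ?thesis by simp
qed

text \<open>The linear inequalities behind a single step of the generation operator. The numbers \<open>a\<close>, \<open>b\<close>, \<open>c\<close>,
  \<open>d\<close> are the new heights, \<open>P i\<close> is twice the position of the side with index \<open>i\<close> in the chain and
  \<open>G i\<close> is its height, \<open>s\<close> is the depth, and \<open>J\<close> expresses the old heights by the new ones. The line at
  height \<open>t / 2\<close> passes through two subintervals, of lengths \<open>J x\<close> and \<open>J y\<close>, of the sides with index
  \<open>s x\<close> and \<open>7 - s y\<close>; it follows that the second side comes after the first and that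
  all sides in between are crossed. Everything depends on \<open>j\<close> only through \<open>k = [j/2]\<close> and through the
  order of the old heights. The assumptions \<open>le\<close> record what the two values of \<open>j\<close> with
  the same \<open>k\<close> have in common; for \<open>k = 0\<close> only \<open>j = 1\<close> occurs.\<close>

lemma chain_crossing:
  fixes a b c d t :: real and P G :: "nat \<Rightarrow> real" and s :: "letter \<Rightarrow> nat" and J :: "letter \<Rightarrow> real"
  assumes k: "k \<in> {0, 1, 2, 3 :: nat}"
    and P: "P 0 = 5 * d + c - 6 * a - 3 * b" "P (Suc 0) = 4 * d + c - 5 * a - 3 * b"
      "P 2 = 3 * d + c - 3 * a - 2 * b" "P 3 = d - a - b" "P 4 = a + b - d"
      "P 5 = 3 * a + 2 * b - c - 3 * d" "P 6 = 5 * a + 3 * b - c - 4 * d"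
      "P 7 = 6 * a + 3 * b - c - 5 * d"
   and G: "G 0 = a" "G (Suc 0) = d" "G 2 = b" "G 3 = c" "G 4 = c" "G 5 = b" "G 6 = d" "G 7 = a"
   and s: "s A = 0" "s B = (if k = 3 then 5 else 2)" "s C = (if k \<le> 1 then 4 else 3)"
     "s D = (if k = 0 then 6 else 1)"
   and J: "J A = a" "J B = (if k = 3 then 2 * d - 2 * a - b else b + 2 * a - 2 * d)"
     "J C = (if k \<le> 1 then 2 * a + 2 * b - 2 * d - c else c + 2 * d - 2 * a - 2 * b)"
     "J D = (if k = 0 then 2 * a - d else d - 2 * a)"
   and le: "k = 0 \<Longrightarrow> 0 \<le> J D \<and> J D \<le> J A \<and> J A \<le> J C \<and> J C \<le> J B"
     "k = 1 \<Longrightarrow> 0 \<le> J C \<and> 0 \<le> J D \<and> J C \<le> J A \<and> J C \<le> J B \<and> J D \<le> J A \<and> J D \<le> J B"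
     "k = 2 \<Longrightarrow> 0 \<le> J B \<and> 0 \<le> J C \<and> J B \<le> J A \<and> J B \<le> J D \<and> J C \<le> J A \<and> J C \<le> J D"
     "k = 3 \<Longrightarrow> 0 \<le> J A \<and> 0 \<le> J B \<and> J A \<le> J C \<and> J A \<le> J D \<and> J B \<le> J C \<and> J B \<le> J D"
   and x: "\<bar>t + P (s x)\<bar> < J x" and y: "\<bar>t + P (7 - s y)\<bar> < J y"
  shows "s x + s y \<le> 6 \<and> (\<forall>i\<le>7. s x \<le> i \<and> i \<le> 7 - s y \<longrightarrow> \<bar>t + P i\<bar> < G i)"
proof -
  have all_le_7: "(\<forall>i\<le>7. P i) \<longleftrightarrow> P 0 \<and> P (Suc 0) \<and> P 2 \<and> P 3 \<and> P 4 \<and> P 5 \<and> P 6 \<and> P (7::nat)" for P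
    by (auto dest: less_8_cases)
  have eqs: "7 - 0 = (7::nat)" "7 - 2 = (5::nat)" "7 - 3 = (4::nat)" "7 - 4 = (3::nat)"
    "7 - 5 = (2::nat)" "7 - 6 = Suc 0" "7 - Suc 0 = (6::nat)" by simp_all
  consider "k = 0" | "k = 1" | "k = 2" | "k = 3" using k by auto
  then show ?thesis
  proof cases
    case 1
    have s': "s B = 2" "s C = 4" "s D = 6" using s 1 by simp_all
    have J': "J B = b + 2 * a - 2 * d" "J C = 2 * a + 2 * b - 2 * d - c" "J D = 2 * a - d"
      using J 1 by simp_all
    show ?thesis
      using x y le(1)[OF 1] unfolding abs_less_iff all_le_7
      by (cases x; cases y; simp only: s(1) s' eqs P G J(1) J'; simp del: linorder_not_less;
        (intro conjI)?; linarith?)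
  next
    case 2
    have s': "s B = 2" "s C = 4" "s D = Suc 0" using s 2 by simp_all
    have J': "J B = b + 2 * a - 2 * d" "J C = 2 * a + 2 * b - 2 * d - c" "J D = d - 2 * a"
      using J 2 by simp_all
    show ?thesis
      using x y le(2)[OF 2] unfolding abs_less_iff all_le_7
      by (cases x; cases y; simp only: s(1) s' eqs P G J(1) J'; simp del: linorder_not_less;
        (intro conjI)?; linarith?)
  next
    case 3
    have s': "s B = 2" "s C = 3" "s D = Suc 0" using s 3 by simp_all
    have J': "J B = b + 2 * a - 2 * d" "J C = c + 2 * d - 2 * a - 2 * b" "J D = d - 2 * a"
      using J 3 by simp_all
    show ?thesis
      using x y le(3)[OF 3] unfolding abs_less_iff all_le_7
      by (cases x; cases y; simp only: s(1) s' eqs P G J(1) J'; simp del: linorder_not_less;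
        (intro conjI)?; linarith?)
  next
    case 4
    have s': "s B = 5" "s C = 3" "s D = Suc 0" using s 4 by simp_all
    have J': "J B = 2 * d - 2 * a - b" "J C = c + 2 * d - 2 * a - 2 * b" "J D = d - 2 * a"
      using J 4 by simp_all
    show ?thesis
      using x y le(4)[OF 4] unfolding abs_less_iff all_le_7
      by (cases x; cases y; simp only: s(1) s' eqs P G J(1) J'; simp del: linorder_not_less;
        (intro conjI)?; linarith?)
  qed
qed

text \<open>The hypotheses say that a line at height \<open>\<zeta>\<close> along the chain represents a step from \<open>x\<close> to \<open>y\<close> of
  an orbit for the old heights.\<close>

lemma generated_transition:
  assumes j: "j \<in> {1..7}" and h: "0 \<le> h A" "h A \<le> h D" "h D \<le> h B" "h B \<le> h C"
  defines "g \<equiv> generated_heights j h"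
  assumes x: "2 * \<bar>\<zeta> + chain_position g (depth j x)\<bar> < h (perm j x)"
    and y: "2 * \<bar>\<zeta> + chain_position g (7 - depth j y)\<bar> < h (perm j y)"
  shows "depth j x + depth j y \<le> 6"
    and "\<And>i. depth j x \<le> i \<Longrightarrow> i \<le> 7 - depth j y \<Longrightarrow> 2 * \<bar>\<zeta> + chain_position g i\<bar> < g (chain ! i)"
proof -
  have j': "j \<in> {1, 2, 3, 4, 5, 6, 7}" using j by auto
  have k: "j div 2 \<in> {0, 1, 2, 3}" and j7: "j \<le> 7" using j by auto
  have abs: "2 * \<bar>\<zeta> + p\<bar> = \<bar>2 * \<zeta> + 2 * p\<bar>" for p by (simp add: abs_if)
  have J: "h (perm j A) = g A"
    "h (perm j B) = (if j div 2 = 3 then 2 * g D - 2 * g A - g B else g B + 2 * g A - 2 * g D)"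
    "h (perm j C) = (if j div 2 \<le> 1 then 2 * g A + 2 * g B - 2 * g D - g C else g C + 2 * g D - 2 * g A - 2 * g B)"
    "h (perm j D) = (if j div 2 = 0 then 2 * g A - g D else g D - 2 * g A)"
    using j' unfolding g_def by (elim insertE emptyE; simp add: generated_heights_table)+
  have order: "0 \<le> h z" "h A \<le> h z" "h z \<le> h C" "h D \<le> h B" for z
    using h by (cases z; simp)+
  have le: "j div 2 = 0 \<Longrightarrow> 0 \<le> h (perm j D) \<and> h (perm j D) \<le> h (perm j A) \<and> h (perm j A) \<le> h (perm j C) \<and> h (perm j C) \<le> h (perm j B)"
     "j div 2 = 1 \<Longrightarrow> 0 \<le> h (perm j C) \<and> 0 \<le> h (perm j D) \<and> h (perm j C) \<le> h (perm j A) \<and> h (perm j C) \<le> h (perm j B) \<and> h (perm j D) \<le> h (perm j A) \<and> h (perm j D) \<le> h (perm j B)"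
     "j div 2 = 2 \<Longrightarrow> 0 \<le> h (perm j B) \<and> 0 \<le> h (perm j C) \<and> h (perm j B) \<le> h (perm j A) \<and> h (perm j B) \<le> h (perm j D) \<and> h (perm j C) \<le> h (perm j A) \<and> h (perm j C) \<le> h (perm j D)"
     "j div 2 = 3 \<Longrightarrow> 0 \<le> h (perm j A) \<and> 0 \<le> h (perm j B) \<and> h (perm j A) \<le> h (perm j C) \<and> h (perm j A) \<le> h (perm j D) \<and> h (perm j B) \<le> h (perm j C) \<and> h (perm j B) \<le> h (perm j D)"
    using j' by (elim insertE emptyE; simp add: perm_table order)+
  have "depth j x + depth j y \<le> 6 \<and> (\<forall>i\<le>7. depth j x \<le> i \<and> i \<le> 7 - depth j y \<longrightarrow>
      \<bar>2 * \<zeta> + 2 * chain_position g i\<bar> < g (chain ! i))"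
    by (rule chain_crossing[where k = "j div 2" and s = "depth j" and J = "\<lambda>x. h (perm j x)"
      and P = "\<lambda>i. 2 * chain_position g i" and G = "\<lambda>i. g (chain ! i)",
      OF k chain_position_table chain_table[THEN arg_cong[where f = g]] depth_table[OF j7] J le
        x[unfolded abs] y[unfolded abs]])
  then show "depth j x + depth j y \<le> 6"
    and "\<And>i. depth j x \<le> i \<Longrightarrow> i \<le> 7 - depth j y \<Longrightarrow> 2 * \<bar>\<zeta> + chain_position g i\<bar> < g (chain ! i)"
    unfolding abs by auto
qed

text \<open>Each step of the given orbit is replaced by the orbit segment along the chain that represents it.
  Consecutive segments fit together because the last point of one is the first point of the next:
  both have as offset the transformed offset of the same point of the given orbit.\<close>

lemma octagon_coded_gen0:
  assumes j: "j \<in> {1..7}" and coded: "octagon_coded (perm j \<circ> u)"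
  shows "octagon_coded (gen0 j u)"
proof -
  obtain h z where h: "octagon_heights h" and z: "periodic_orbit h z" and zu: "perm j \<circ> u = fst \<circ> z"
    using coded by (auto simp: octagon_coded_def)
  obtain N where hits: "\<And>n. hits h (z n)" and follows: "\<And>n. follows h (z n) (z (n + 1))"
    and N: "N > 0" "\<And>n. z (n + N) = z n"
    using z by (auto simp: periodic_orbit_def)
  have j7: "j \<le> 7" using j by simp
  have inj: "inj (perm j)" using bij_perm[OF j7] by (rule bij_is_inj)
  have h_le: "0 \<le> h A" "h A \<le> h D" "h D \<le> h B" "h B \<le> h C"
    using h octagon_heights_ratios[OF h] by (auto simp: octagon_heights_def)
  define \<xi> where "\<xi> n = snd (z n)" for n
  have z_eq: "z n = (perm j (u n), \<xi> n)" for n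
    using fun_cong[OF zu, of n] by (simp add: \<xi>_def prod_eq_iff)
  have u_N: "u (n + N) = u n" and \<xi>_N: "\<xi> (n + N) = \<xi> n" for n
    using N(2)[of n] inj unfolding z_eq by (simp_all add: inj_eq)
  define g where "g = generated_heights j h"
  define s where "s n = depth j (u n)" for n
  define \<zeta> where "\<zeta> n = orientation j * \<xi> n - chain_position g (s n)" for n
  have mid: "chain_position g (s n) = orientation j * midheight h (perm j (u n))" for n
    unfolding g_def s_def using j by (rule chain_position_depth)
  have s7: "s n \<le> 6" for n unfolding s_def using j7 by (rule depth_bound)
  have start: "\<zeta> n + chain_position g (s n) = orientation j * \<xi> n" for n by (simp add: \<zeta>_def)
  have stop: "\<zeta> n + chain_position g (7 - s (n + 1)) = orientation j * \<xi> (n + 1)" for n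
  proof -
    have "s (n + 1) \<le> 7" using s7[of "n + 1"] by simp
    then show ?thesis
      using follows[of n] unfolding z_eq
      by (simp add: chain_position_reverse mid \<zeta>_def follows_def right_diff_distrib)
  qed
  have abs: "\<bar>orientation j * x\<bar> = \<bar>x\<bar>" for x by (simp add: orientation_def)
  have bound: "2 * \<bar>\<xi> n\<bar> < h (perm j (u n))" for n
    using hits[of n] by (simp add: z_eq hits_def)
  have x: "2 * \<bar>\<zeta> n + chain_position g (s n)\<bar> < h (perm j (u n))"
    and y: "2 * \<bar>\<zeta> n + chain_position g (7 - s (n + 1))\<bar> < h (perm j (u (n + 1)))" for n
    unfolding start stop abs using bound by simp_all
  note transition = generated_transition[OF j h_le x[unfolded g_def s_def] y[unfolded g_def s_def],
    folded g_def s_def]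
  define p where "p n i = (chain ! i, \<zeta> n + chain_position g i)" for n i
  define b where "b n = map (p n) [s n..<7 - s (n + 1)]" for n
  have less: "s n < 7 - s (n + 1)" for n using transition(1)[of n] by simp
  have ne: "b n \<noteq> []" for n using less[of n] by (simp add: b_def)
  have hd: "hd (b n) = p n (s n)" for n using less[of n] by (simp add: b_def hd_map)
  have glue: "b n @ [hd (b (n + 1))] = map (p n) [s n..<8 - s (n + 1)]" for n
  proof -
    have "p (n + 1) (s (n + 1)) = p n (7 - s (n + 1))"
      using start[of "n + 1"] stop[of n] chain_depth(1,2)[OF j7, of "u (n + 1)"]
      by (simp add: p_def s_def)
    moreover have "8 - s (n + 1) = Suc (7 - s (n + 1))" using s7[of "n + 1"] by simp
    ultimately show ?thesis using less[of n] unfolding hd by (simp add: b_def)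
  qed
  have "hits g (bi_concat b m)" for m
  proof (rule bi_concat_all[OF ne])
    fix n q assume "q \<in> set (b n)"
    then obtain i where "q = p n i" "s n \<le> i" "i \<le> 7 - s (n + 1)" by (auto simp: b_def)
    then show "hits g q" using transition(2)[of n i] by (simp add: p_def hits_def)
  qed
  moreover have "follows g (bi_concat b m) (bi_concat b (m + 1))" for m
  proof (rule bi_concat_successive[OF ne])
    show "successively (follows g) (b n @ [hd (b (n + 1))])" for n
      unfolding glue by (auto simp: successively_conv_nth p_def follows_def chain_position.simps)
  qed
  moreover have "bi_concat b (m + block_start b N) = bi_concat b m" for m
  proof (rule bi_concat_periodic[OF ne])
    have "s (n + N) = s n" "s (n + N + 1) = s (n + 1)" for n
      using u_N[of n] u_N[of "n + 1"] by (simp_all add: s_def add_ac)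
    then show "b (n + N) = b n" for n by (simp add: b_def p_def \<zeta>_def \<xi>_N fun_eq_iff)
  qed
  moreover have "block_start b N > 0"
    using strict_monoD[OF block_start_strict_mono[OF ne] N(1)] by (simp add: block_start_cumulative)
  ultimately have "periodic_orbit g (bi_concat b)" unfolding periodic_orbit_def by blast
  moreover have "octagon_heights g" unfolding g_def using j h by (rule generated_heights_octagon)
  moreover have "gen0 j u = fst \<circ> bi_concat b"
  proof -
    have "map fst (b n) = u n # interpolating_word j (u n) (u (n + 1))" for n
    proof -
      have "interpolating_word j (u n) (u (n + 1)) = map ((!) chain) [Suc (s n)..<7 - s (n + 1)]"
        unfolding s_def using transition(1)[of n]
        by (intro interpolating_word_eq[OF j7] interpolates_chain[OF j7]) (simp add: s_def)
      then show ?thesis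
        using less[of n] chain_depth(1)[OF j7, of "u n"]
        by (simp add: b_def p_def s_def upt_conv_Cons comp_def)
    qed
    then have "gen0 j u = bi_concat (\<lambda>n. map fst (b n))" by (simp add: gen0_def)
    then show ?thesis by (simp add: bi_concat_map[OF ne])
  qed
  ultimately show ?thesis unfolding octagon_coded_def by blast
qed

text \<open>A trajectory through the midpoints of two sides with opposite midheights returns after two
  crossings. In the direction 0 this happens for \<open>BD\<close> and \<open>CC\<close>, in the direction \<open>\<pi>/8\<close>, where the
  heights are proportional to \<open>1\<close> and \<open>1 + \<surd>2\<close>, for \<open>AD\<close> and \<open>BC\<close>.\<close>

lemma octagon_coded_alternating:
  assumes v: "\<And>n. v (n + 2) = v n" and t: "trans0 (v 0) (v 1)"
  shows "octagon_coded v"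
proof -
  have s: "sqrt 2 * sqrt 2 = (2::real)" "1 < sqrt (2::real)" by simp_all
  then have pos: "0 < 1 + sqrt (2::real)" by linarith
  define horizontal where "horizontal x = (case x of A \<Rightarrow> 0 | B \<Rightarrow> 1 | C \<Rightarrow> sqrt 2 | D \<Rightarrow> (1::real))" for x
  define diagonal where "diagonal x = (case x of A \<Rightarrow> 1 | B \<Rightarrow> 1 + sqrt 2 | C \<Rightarrow> 1 + sqrt 2 | D \<Rightarrow> (1::real))" for x
  have "octagon_heights horizontal" by (simp add: octagon_heights_def horizontal_def)
  moreover have "octagon_heights diagonal"
    using s pos by (simp add: octagon_heights_def diagonal_def distrib_left)
  moreover have "\<exists>h\<in>{horizontal, diagonal}. 0 < h (v 0) \<and> 0 < h (v 1) \<and> 2 * midheight h (v 0) + 2 * midheight h (v 1) = 0"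
    using t pos by (cases "v 0"; cases "v 1") (simp_all add: trans0_def midheight_table horizontal_def diagonal_def)
  ultimately obtain h where h: "octagon_heights h"
    and *: "0 < h (v 0)" "0 < h (v 1)" "2 * midheight h (v 0) + 2 * midheight h (v 1) = 0" by blast
  have "v (n + 2 * k) = v n" for n k
  proof (induction k rule: int_induct[where k = 0])
    case (step1 i)
    then show ?case using v[of "n + 2 * i"] by (simp add: algebra_simps)
  next
    case (step2 i)
    then show ?case using v[of "n + 2 * (i - 1)"] by (simp add: algebra_simps)
  qed simp
  then have "v (n mod 2) = v n" for n
    by (metis mod_mult_div_eq)
  then have val: "v n = (if even n then v 0 else v 1)" for n
    by (metis even_iff_mod_2_eq_zero odd_iff_mod_2_eq_one)
  have "periodic_orbit h (\<lambda>n. (v n, 0))"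
    unfolding periodic_orbit_def
  proof (intro conjI allI exI[of _ 2])
    show "hits h (v n, 0)" for n using * val[of n] by (simp add: hits_def)
    show "follows h (v n, 0) (v (n + 1), 0)" for n
      using * val[of n] val[of "n + 1"] by (simp add: follows_def)
  qed (simp_all add: v)
  moreover have "v = fst \<circ> (\<lambda>n. (v n, 0 :: real))" by (simp add: fun_eq_iff)
  ultimately show ?thesis using h unfolding octagon_coded_def by blast
qed

lemma octagon_coded_periodic_words:
  assumes "u \<in> periodic_words i"
  shows "octagon_coded (perm i \<circ> u)"
proof (rule octagon_coded_alternating)
  obtain p where p: "p \<in> {1, 2}" "\<forall>n. u (n + p) = u n" using assms by (auto simp: periodic_words_def)
  have "u (n + 2) = u n" for n
  proof (cases "p = 1")
    case True
    then show ?thesis using p(2)[rule_format, of n] p(2)[rule_format, of "n + 1"] by (simp add: add.assoc)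
  qed (use p in auto)
  then show "(perm i \<circ> u) (n + 2) = (perm i \<circ> u) n" for n by simp
  show "trans0 ((perm i \<circ> u) 0) ((perm i \<circ> u) 1)"
    using assms by (auto simp: periodic_words_def admissible_in_def dest: spec[of _ 0])
qed

lemma octagon_coded_generated_words:
  assumes s: "s \<in> Sstar" and c: "c \<in> generated_words s k"
  shows "octagon_coded (perm (s 0) \<circ> c)"
proof -
  have "octagon_coded (perm (s 0) \<circ> gen_iter s k u)" if "octagon_coded (perm (s k) \<circ> u)" for u
    using that
  proof (induction k arbitrary: u)
    case (Suc k)
    have j: "s (Suc k) \<in> {1..7}" and "s k \<le> 7"
      using s by (cases k; auto simp: Sstar_def)+
    then have "perm (s k) \<circ> gen (s k) (s (Suc k)) u = gen0 (s (Suc k)) u"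
      using bij_is_surj[OF bij_perm] by (simp add: gen_def fun_eq_iff surj_f_inv_f)
    then show ?case using Suc.IH octagon_coded_gen0[OF j Suc.prems] by (metis gen_iter.simps(2))
  qed simp
  then show ?thesis using c octagon_coded_periodic_words by (auto simp: generated_words_def)
qed

section \<open>Construction of periodic trajectories\<close>

lemma cot_pi_8: "cos (pi / 8) = (1 + sqrt 2) * sin (pi / 8)"
proof -
  have "sqrt 2 / 2 = 1 - 2 * sin (pi / 8) ^ 2"
    using cos_double_sin[of "pi / 8"] by (simp add: cos_45)
  then have c: "2 * sin (pi / 8) ^ 2 = 1 - sqrt 2 / 2" by linarith
  have s: "sqrt 2 / 2 = 2 * sin (pi / 8) * cos (pi / 8)"
    using sin_double[of "pi / 8"] by (simp add: sin_45)
  have "0 < sin (pi / 8)" by (rule sin_gt_zero) auto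
  moreover have "2 * sin (pi / 8) * ((1 + sqrt 2) * sin (pi / 8)) = 2 * sin (pi / 8) * cos (pi / 8)"
  proof -
    have "2 * sin (pi / 8) * ((1 + sqrt 2) * sin (pi / 8)) = (1 + sqrt 2) * (2 * sin (pi / 8) ^ 2)"
      by (simp add: power2_eq_square)
    also have "\<dots> = (1 + sqrt 2) * (1 - sqrt 2 / 2)" unfolding c ..
    also have "\<dots> = sqrt 2 / 2" by (simp add: algebra_simps)
    finally show ?thesis using s by simp
  qed
  ultimately show ?thesis by simp
qed

lemma cis_45: "cis (pi / 4) = Complex (sqrt 2 / 2) (sqrt 2 / 2)"
  "cis (- (pi / 4)) = Complex (sqrt 2 / 2) (- (sqrt 2 / 2))"
  by (simp_all add: complex_eq_iff cos_45 sin_45)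

lemma vertex_rotate: "vertex (Suc j) = cis (- (pi / 4)) * vertex j"
proof -
  have "5 * pi / 8 - (real (Suc j) - 1) * pi / 4 = - (pi / 4) + (5 * pi / 8 - (real j - 1) * pi / 4)"
    by (simp add: field_simps)
  then show ?thesis unfolding vertex_def by (simp only: cis_mult[symmetric] times_divide_eq_right)
qed

lemma vertex_table:
  "vertex 1 = Complex (- 1 / 2) ((1 + sqrt 2) / 2)"
  "vertex 2 = Complex (1 / 2) ((1 + sqrt 2) / 2)"
  "vertex 3 = Complex ((1 + sqrt 2) / 2) (1 / 2)"
  "vertex 4 = Complex ((1 + sqrt 2) / 2) (- 1 / 2)"
  "vertex 5 = Complex (1 / 2) (- (1 + sqrt 2) / 2)"
  "vertex 6 = Complex (- 1 / 2) (- (1 + sqrt 2) / 2)"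
  "vertex 7 = Complex (- (1 + sqrt 2) / 2) (- 1 / 2)"
  "vertex 8 = Complex (- (1 + sqrt 2) / 2) (1 / 2)"
  "vertex 9 = Complex (- 1 / 2) ((1 + sqrt 2) / 2)"
proof -
  have "5 * pi / 8 = pi / 2 + pi / 8" by simp
  then have "cos (5 * pi / 8) = - sin (pi / 8)" "sin (5 * pi / 8) = cos (pi / 8)"
    by (simp_all only: cos_add sin_add) simp_all
  moreover have "sin (pi / 8) \<noteq> 0" using sin_gt_zero[of "pi / 8"] by simp
  ultimately show 1: "vertex 1 = Complex (- 1 / 2) ((1 + sqrt 2) / 2)"
    by (simp add: vertex_def complex_eq_iff Re_divide_of_real Im_divide_of_real cot_pi_8 del: of_real_mult)
  note step = vertex_rotate[unfolded cis_45]
  show 2: "vertex 2 = Complex (1 / 2) ((1 + sqrt 2) / 2)"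
    using step[of 1] unfolding 1 by (simp add: complex_eq_iff numeral_eq_Suc field_simps)
  show 3: "vertex 3 = Complex ((1 + sqrt 2) / 2) (1 / 2)"
    using step[of 2] unfolding 2 by (simp add: complex_eq_iff field_simps)
  show 4: "vertex 4 = Complex ((1 + sqrt 2) / 2) (- 1 / 2)"
    using step[of 3] unfolding 3 by (simp add: complex_eq_iff field_simps)
  show 5: "vertex 5 = Complex (1 / 2) (- (1 + sqrt 2) / 2)"
    using step[of 4] unfolding 4 by (simp add: complex_eq_iff field_simps)
  show 6: "vertex 6 = Complex (- 1 / 2) (- (1 + sqrt 2) / 2)"
    using step[of 5] unfolding 5 by (simp add: complex_eq_iff field_simps)
  show 7: "vertex 7 = Complex (- (1 + sqrt 2) / 2) (- 1 / 2)"
    using step[of 6] unfolding 6 by (simp add: complex_eq_iff field_simps)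
  show 8: "vertex 8 = Complex (- (1 + sqrt 2) / 2) (1 / 2)"
    using step[of 7] unfolding 7 by (simp add: complex_eq_iff field_simps)
  show "vertex 9 = Complex (- 1 / 2) ((1 + sqrt 2) / 2)"
    using step[of 8] unfolding 8 by (simp add: complex_eq_iff field_simps)
qed

text \<open>A point of a convex set is interior unless some nonzero linear functional is minimal there. This
  covers sets with empty interior, on which some functional is constant.\<close>

lemma supporting_functional:
  fixes S :: "'a::euclidean_space set"
  assumes S: "convex S" and p: "p \<in> S" "p \<notin> interior S"
  shows "\<exists>a. a \<noteq> 0 \<and> (\<forall>x\<in>S. a \<bullet> p \<le> a \<bullet> x)"
proof (cases "interior S = {}")
  case True
  then obtain a b where a: "a \<noteq> 0" and "S \<subseteq> {x. a \<bullet> x = b}"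
    using empty_interior_subset_hyperplane[OF S] by blast
  then have "a \<bullet> x = b" if "x \<in> S" for x using that by blast
  then show ?thesis using p(1) a by (intro exI[of _ a]) simp
next
  case False
  have "p \<notin> rel_interior S" using p(2) False by (simp add: rel_interior_nonempty_interior)
  then show ?thesis using supporting_hyperplane_rel_boundary[OF S p(1)] by metis
qed

text \<open>A trajectory is determined by the points \<open>p n\<close> at which it enters, the points \<open>q n\<close> at which it
  leaves, and the durations \<open>l n\<close> in between. Periodicity is what makes the crossing times
  exhaust the line: they grow by the same amount in each period.\<close>

lemma periodic_crossings:
  fixes p q :: "int \<Rightarrow> complex" and l :: "int \<Rightarrow> real"
  assumes v: "v \<noteq> 0" and l: "\<And>n. 0 < l n" and pq: "\<And>n. q (n + 1) = p n + l n *\<^sub>R v"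
    and \<sigma>: "\<And>n. \<sigma> n \<in> {1..8}" and side: "\<And>n. q n \<in> side (\<sigma> n)" and glue: "\<And>n. p n = glue (\<sigma> n) (q n)"
    and interior: "\<And>n. open_segment (p n) (q (n + 1)) \<subseteq> interior octagon"
    and N: "0 < N" and per: "\<And>n. p (n + N) = p n" "\<And>n. l (n + N) = l n"
  shows "\<exists>\<tau> t. crossings \<tau> t \<sigma> \<and> (\<exists>T>0. \<forall>r. \<tau> (r + T) = \<tau> r)"
proof -
  define t where "t = cumulative l"
  have step: "t (n + 1) = t n + l n" for n by (simp add: t_def cumulative_step)
  have mono: "strict_mono t" unfolding t_def by (rule cumulative_strict_mono) (rule l)
  define T where "T = t N"
  have T: "t (n + N) = t n + T" for n unfolding t_def T_def by (rule cumulative_periodic) (rule per)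
  have "0 < T" using strict_monoD[OF mono N] by (simp add: T_def t_def)
  have multiple: "t (int k * N) = real k * T" "t (- (int k * N)) = - (real k * T)" for k
  proof (induction k)
    case (Suc k)
    show "t (int (Suc k) * N) = real (Suc k) * T"
      using T[of "int k * N"] Suc by (simp add: algebra_simps)
    show "t (- (int (Suc k) * N)) = - (real (Suc k) * T)"
      using T[of "- (int (Suc k) * N)"] Suc by (simp add: algebra_simps)
  qed (simp_all add: t_def)
  have above: "\<exists>n. r < t n" for r
  proof -
    obtain k where "r < real k * T" using reals_Archimedean3[OF \<open>0 < T\<close>] by blast
    then show ?thesis using multiple(1)[of k] by (intro exI[of _ "int k * N"]) simp
  qed
  have below: "\<exists>n. t n < r" for r
  proof -
    obtain k where "- r < real k * T" using reals_Archimedean3[OF \<open>0 < T\<close>] by blast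
    then show ?thesis using multiple(2)[of k] by (intro exI[of _ "- (int k * N)"]) simp
  qed
  have at_top: "filterlim t at_top at_top"
    unfolding filterlim_at_top eventually_at_top_linorder
  proof
    fix r
    obtain n where "r < t n" using above by blast
    then show "\<exists>n. \<forall>m\<ge>n. r \<le> t m"
      using strict_mono_less_eq[OF mono, of n] by (intro exI[of _ n]) (meson less_imp_le order_trans)
  qed
  have at_bot: "filterlim t at_bot at_bot"
    unfolding filterlim_at_bot eventually_at_bot_linorder
  proof
    fix r
    obtain n where "t n < r" using below by blast
    then show "\<exists>n. \<forall>m\<le>n. t m \<le> r"
      using strict_mono_less_eq[OF mono, of _ n] by (intro exI[of _ n]) (meson less_imp_le order_trans)
  qed
  define idx where "idx r = (THE n. t n \<le> r \<and> r < t (n + 1))" for r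
  have ex1: "\<exists>!n. t n \<le> r \<and> r < t (n + 1)" for r
  proof -
    obtain a b where "t a < r" "r < t b" using above[of r] below[of r] by blast
    then show ?thesis by (intro strict_mono_int_locate[OF mono, of a r b]) simp_all
  qed
  have idx: "idx r = n" if "t n \<le> r" "r < t (n + 1)" for r n
    unfolding idx_def using that by (intro the1_equality[OF ex1]) simp
  have idx': "t (idx r) \<le> r" "r < t (idx r + 1)" for r
    using theI'[OF ex1[of r]] by (simp_all add: idx_def)
  define \<tau> where "\<tau> r = p (idx r) + (r - t (idx r)) *\<^sub>R v" for r
  have start: "\<tau> (t n) = p n" for n
    using idx[of n "t n"] strict_mono_intD[OF mono, of n] by (simp add: \<tau>_def)
  have "crossings \<tau> t \<sigma>"
    unfolding crossings_def Let_def
  proof (intro conjI allI exI[of _ v] ballI)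
    fix n
    show "\<tau> r = \<tau> (t n) + (r - t n) *\<^sub>R v" if "r \<in> {t n..<t (n + 1)}" for r
      using that idx[of n r] by (simp add: start) (simp add: \<tau>_def)
    have q: "\<tau> (t n) + (t (n + 1) - t n) *\<^sub>R v = q (n + 1)" by (simp add: start step pq)
    show "\<tau> (t n) + (t (n + 1) - t n) *\<^sub>R v \<in> side (\<sigma> (n + 1))"
      unfolding q by (rule side)
    show "\<tau> (t (n + 1)) = glue (\<sigma> (n + 1)) (\<tau> (t n) + (t (n + 1) - t n) *\<^sub>R v)"
      unfolding q unfolding start by (rule glue)
    show "\<tau> r \<in> interior octagon" if r: "r \<in> {t n<..<t (n + 1)}" for r
    proof (rule subsetD[OF interior[of n]])
      obtain u where u: "0 < u" "u < 1" "u * l n = r - t n"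
      proof
        show "0 < (r - t n) / l n" "(r - t n) / l n < 1" "(r - t n) / l n * l n = r - t n"
          using r l[of n] step[of n] by auto
      qed
      have "\<tau> r = p n + (u * l n) *\<^sub>R v" unfolding u(3) using r idx[of n r] by (simp add: \<tau>_def)
      also have "\<dots> = (1 - u) *\<^sub>R p n + u *\<^sub>R q (n + 1)" unfolding pq by (simp add: algebra_simps)
      finally show "\<tau> r \<in> open_segment (p n) (q (n + 1))"
        using u(1,2) l[of n] v by (auto simp: in_segment pq)
    qed
  qed (use v \<sigma> mono at_top at_bot in auto)
  moreover have "\<tau> (r + T) = \<tau> r" for r
  proof -
    have "t (idx r + N + 1) = t (idx r + 1) + T" using T[of "idx r + 1"] by (simp add: add_ac)
    then have "idx (r + T) = idx r + N" using idx'[of r] T[of "idx r"] by (intro idx) auto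
    then show ?thesis by (simp add: \<tau>_def T per)
  qed
  ultimately show ?thesis using \<open>0 < T\<close> by blast
qed

definition exit_side :: "letter \<Rightarrow> nat" where
  "exit_side x = (case x of A \<Rightarrow> 1 | B \<Rightarrow> 2 | C \<Rightarrow> 3 | D \<Rightarrow> 4)"

text \<open>The parameter \<open>\<kappa>\<close> is the offset from the midpoint in units of the side; it increases towards the
  vertex with the smaller number, which is the upper one for directions in \<open>[0, \<pi>/8]\<close>. The points
  of the opposite side are the negatives of these.\<close>

definition side_point :: "letter \<Rightarrow> real \<Rightarrow> complex" where
  "side_point x \<kappa> = (1 / 2 + \<kappa>) *\<^sub>R vertex (exit_side x) + (1 / 2 - \<kappa>) *\<^sub>R vertex (exit_side x + 1)"

text \<open>A linear functional along the outer normal of the exit side \<open>x\<close>.\<close>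

definition outwardness :: "letter \<Rightarrow> complex \<Rightarrow> real" where
  "outwardness x p = (case x of A \<Rightarrow> Im p | B \<Rightarrow> Re p + Im p | C \<Rightarrow> Re p | D \<Rightarrow> Re p - Im p)"

lemma exit_side_table:
  "exit_side A = 1" "exit_side B = 2" "exit_side C = 3" "exit_side D = 4"
  by (simp_all add: exit_side_def)

lemma side_point_coordinates:
  "Re (side_point A \<kappa>) = - \<kappa>" "2 * Im (side_point A \<kappa>) = 1 + sqrt 2"
  "4 * Re (side_point B \<kappa>) = 2 + sqrt 2 - 2 * (sqrt 2 * \<kappa>)"
  "4 * Im (side_point B \<kappa>) = 2 + sqrt 2 + 2 * (sqrt 2 * \<kappa>)"
  "2 * Re (side_point C \<kappa>) = 1 + sqrt 2" "Im (side_point C \<kappa>) = \<kappa>"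
  "4 * Re (side_point D \<kappa>) = 2 + sqrt 2 + 2 * (sqrt 2 * \<kappa>)"
  "4 * Im (side_point D \<kappa>) = - 2 - sqrt 2 + 2 * (sqrt 2 * \<kappa>)"
proof -
  have n: "1 + 1 = (2 :: nat)" "2 + 1 = (3 :: nat)" "3 + 1 = (4 :: nat)" "4 + 1 = (5 :: nat)" by simp_all
  note unfold = side_point_def exit_side_table n vertex_table plus_complex.sel scaleR_complex.sel complex.sel
  show "Re (side_point A \<kappa>) = - \<kappa>" "2 * Im (side_point A \<kappa>) = 1 + sqrt 2"
    "4 * Re (side_point B \<kappa>) = 2 + sqrt 2 - 2 * (sqrt 2 * \<kappa>)"
    "4 * Im (side_point B \<kappa>) = 2 + sqrt 2 + 2 * (sqrt 2 * \<kappa>)"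
    "2 * Re (side_point C \<kappa>) = 1 + sqrt 2" "Im (side_point C \<kappa>) = \<kappa>"
    "4 * Re (side_point D \<kappa>) = 2 + sqrt 2 + 2 * (sqrt 2 * \<kappa>)"
    "4 * Im (side_point D \<kappa>) = - 2 - sqrt 2 + 2 * (sqrt 2 * \<kappa>)"
    unfolding unfold by (simp_all add: field_simps)
qed

lemma glue_exit: "glue (exit_side x) (side_point x \<kappa>) = - side_point x (- \<kappa>)"
  unfolding glue_def side_point_def complex_eq_iff
  by (simp add: algebra_simps)

text \<open>A point of an entry side lies strictly below each exit side with respect to the normal of the
  latter, because the octagon lies below it and the two sides have no inner point in common.\<close>

lemma outwardness_reentry:
  assumes "\<bar>\<kappa>\<bar> < 1 / 2" "\<bar>\<mu>\<bar> < 1 / 2"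
  shows "outwardness y (- side_point x \<kappa>) < outwardness y (side_point y \<mu>)"
proof -
  have s1: "1 < sqrt (2::real)" by simp
  have s2: "sqrt (2::real) < 3 / 2" by (rule real_less_lsqrt) (simp_all add: power2_eq_square)
  have "sqrt 2 * \<kappa> < sqrt 2 * (1 / 2)" "sqrt 2 * (- (1 / 2)) < sqrt 2 * \<kappa>"
    using assms(1) by (intro mult_strict_left_mono; simp)+
  moreover have "\<kappa> < 1 / 2" "- (1 / 2) < \<kappa>" using assms(1) by auto
  ultimately show ?thesis
    using s1 s2 side_point_coordinates[of \<kappa>] side_point_coordinates[of \<mu>]
    by (cases x; cases y; simp only: outwardness_def letter.case uminus_complex.sel; linarith)
qed

lemma vertex_opposite: "vertex (j + 4) = - vertex j"
proof -
  have "5 * pi / 8 - (real (j + 4) - 1) * pi / 4 = (5 * pi / 8 - (real j - 1) * pi / 4) - pi"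
    by (simp add: field_simps)
  moreover have "cis (x - pi) = - cis x" for x by (simp add: complex_eq_iff cos_diff sin_diff)
  ultimately show ?thesis unfolding vertex_def by (simp only: minus_divide_left)
qed

lemma vertex_9: "vertex 9 = vertex 1"
  using vertex_opposite[of 1] vertex_opposite[of 5] by simp

lemma vertex_in_octagon: "j \<in> {1..9} \<Longrightarrow> vertex j \<in> octagon"
  unfolding octagon_def by (cases "j = 9") (auto simp: vertex_9 intro!: hull_inc)

lemma side_point_octagon:
  assumes "\<bar>\<kappa>\<bar> < 1 / 2"
  shows "side_point x \<kappa> \<in> octagon" "- side_point x \<kappa> \<in> octagon"
proof -
  have conv: "convex octagon" by (simp add: octagon_def)
  have e: "exit_side x \<in> {1..4}" by (cases x) (simp_all add: exit_side_table)
  have "vertex (exit_side x) \<in> octagon" "vertex (exit_side x + 1) \<in> octagon"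
    "- vertex (exit_side x) \<in> octagon" "- vertex (exit_side x + 1) \<in> octagon"
    unfolding vertex_opposite[symmetric] using e by (auto intro!: vertex_in_octagon)
  then show "side_point x \<kappa> \<in> octagon" "- side_point x \<kappa> \<in> octagon"
    using assms convexD[OF conv, of "vertex (exit_side x)" "vertex (exit_side x + 1)" "1 / 2 + \<kappa>" "1 / 2 - \<kappa>"]
      convexD[OF conv, of "- vertex (exit_side x)" "- vertex (exit_side x + 1)" "1 / 2 + \<kappa>" "1 / 2 - \<kappa>"]
    by (simp_all add: side_point_def abs_less_iff)
qed

lemma side_point_ends:
  "side_point x (1 / 2) = vertex (exit_side x)" "side_point x (- (1 / 2)) = vertex (exit_side x + 1)"
  by (simp_all add: side_point_def)

lemma side_point_difference:
  "Re (side_point x (1 / 2)) - Re (side_point x (- (1 / 2))) =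
    (case x of A \<Rightarrow> - 1 | B \<Rightarrow> - (sqrt 2 / 2) | C \<Rightarrow> 0 | D \<Rightarrow> sqrt 2 / 2)" (is ?Re)
  "Im (side_point x (1 / 2)) - Im (side_point x (- (1 / 2))) =
    (case x of A \<Rightarrow> 0 | B \<Rightarrow> sqrt 2 / 2 | C \<Rightarrow> 1 | D \<Rightarrow> sqrt 2 / 2)" (is ?Im)
proof -
  note coord = side_point_coordinates[of "1 / 2"] side_point_coordinates[of "- (1 / 2)"]
  have "?Re \<and> ?Im"
  proof (cases x)
    case A then show ?thesis using coord(1,2,9,10) by (simp only: letter.case; linarith)
  next
    case B then show ?thesis using coord(3,4,11,12) by (simp only: letter.case; linarith)
  next
    case C then show ?thesis using coord(5,6,13,14) by (simp only: letter.case; linarith)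
  next
    case D then show ?thesis using coord(7,8,15,16) by (simp only: letter.case; linarith)
  qed
  then show ?Re ?Im by blast+
qed

lemma side_point_side:
  assumes "\<bar>\<kappa>\<bar> < 1 / 2"
  shows "side_point x \<kappa> \<in> side (exit_side x)"
proof -
  have "side_point x (1 / 2) \<noteq> side_point x (- (1 / 2))"
  proof
    assume "side_point x (1 / 2) = side_point x (- (1 / 2))"
    then show False using side_point_difference[of x] by (cases x) simp_all
  qed
  moreover have "side_point x \<kappa> = (1 - (1 / 2 - \<kappa>)) *\<^sub>R vertex (exit_side x) + (1 / 2 - \<kappa>) *\<^sub>R vertex (exit_side x + 1)"
    by (simp add: side_point_def)
  moreover have "0 < 1 / 2 - \<kappa>" "1 / 2 - \<kappa> < 1" using assms by auto
  ultimately show ?thesis unfolding side_def in_segment side_point_ends by blast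
qed

text \<open>A functional that is minimal at an inner point of the segment is constant on the segment, and
  then also on the exit side, whose end points lie on either side of \<open>side_point y \<mu>\<close>. So it is a
  multiple of the outer normal of that side, on which the two ends of the segment have different
  values.\<close>

lemma segment_interior_octagon:
  assumes "\<bar>\<kappa>\<bar> < 1 / 2" "\<bar>\<mu>\<bar> < 1 / 2"
  shows "open_segment (- side_point x \<kappa>) (side_point y \<mu>) \<subseteq> interior octagon"
proof
  fix p assume "p \<in> open_segment (- side_point x \<kappa>) (side_point y \<mu>)"
  then obtain u where u: "0 < u" "u < 1"
    and p: "p = (1 - u) *\<^sub>R (- side_point x \<kappa>) + u *\<^sub>R side_point y \<mu>"
    by (auto simp: in_segment)
  let ?P = "- side_point x \<kappa>" and ?Q = "side_point y \<mu>"
  let ?V = "vertex (exit_side y)" and ?W = "vertex (exit_side y + 1)"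
  have conv: "convex octagon" by (simp add: octagon_def)
  have PQ: "?P \<in> octagon" "?Q \<in> octagon" using assms by (simp_all add: side_point_octagon)
  have e: "exit_side y \<in> {1..4}" by (cases y) (simp_all add: exit_side_table)
  have VW: "?V \<in> octagon" "?W \<in> octagon" using e by (auto intro!: vertex_in_octagon)
  have "p \<in> octagon" unfolding p using u PQ by (intro convexD[OF conv]) simp_all
  show "p \<in> interior octagon"
  proof (rule ccontr)
    assume "p \<notin> interior octagon"
    then obtain a where a: "a \<noteq> 0" and le: "\<And>z. z \<in> octagon \<Longrightarrow> a \<bullet> p \<le> a \<bullet> z"
      using supporting_functional[OF conv \<open>p \<in> octagon\<close>] by blast
    have equal: "s = m \<and> t = m" if "m \<le> s" "m \<le> t" "m = \<alpha> * s + (1 - \<alpha>) * t" "0 < \<alpha>" "\<alpha> < 1" for m s t \<alpha> :: real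
    proof -
      have "\<alpha> * (s - m) + (1 - \<alpha>) * (t - m) = 0" using that(3) by (simp add: algebra_simps)
      moreover have "0 \<le> \<alpha> * (s - m)" "0 \<le> (1 - \<alpha>) * (t - m)" using that by simp_all
      ultimately have "\<alpha> * (s - m) = 0" "(1 - \<alpha>) * (t - m) = 0" by linarith+
      then show ?thesis using that by simp
    qed
    have "a \<bullet> p = (1 - u) * (a \<bullet> ?P) + (1 - (1 - u)) * (a \<bullet> ?Q)"
      unfolding p by (simp add: inner_diff_right)
    then have ends: "a \<bullet> ?P = a \<bullet> p \<and> a \<bullet> ?Q = a \<bullet> p"
      using u by (intro equal[where \<alpha> = "1 - u", OF le[OF PQ(1)] le[OF PQ(2)]]) simp_all
    have "a \<bullet> ?Q = (1 / 2 + \<mu>) * (a \<bullet> ?V) + (1 - (1 / 2 + \<mu>)) * (a \<bullet> ?W)"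
      unfolding side_point_def by (simp add: inner_add_right)
    moreover have "0 < 1 / 2 + \<mu>" "1 / 2 + \<mu> < 1" using assms(2) by auto
    moreover have "a \<bullet> ?Q \<le> a \<bullet> ?V" "a \<bullet> ?Q \<le> a \<bullet> ?W" using le[OF VW(1)] le[OF VW(2)] ends by simp_all
    ultimately have "a \<bullet> ?V = a \<bullet> ?Q \<and> a \<bullet> ?W = a \<bullet> ?Q" by (intro equal)
    then have "a \<bullet> side_point y (1 / 2) = a \<bullet> side_point y (- (1 / 2))"
      unfolding side_point_ends by simp
    then have "Re a * (Re (side_point y (1 / 2)) - Re (side_point y (- (1 / 2))))
      + Im a * (Im (side_point y (1 / 2)) - Im (side_point y (- (1 / 2)))) = 0"
      by (simp add: inner_complex_def algebra_simps)
    then have orth: "Re a * (case y of A \<Rightarrow> - 1 | B \<Rightarrow> - (sqrt 2 / 2) | C \<Rightarrow> 0 | D \<Rightarrow> sqrt 2 / 2)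
      + Im a * (case y of A \<Rightarrow> 0 | B \<Rightarrow> sqrt 2 / 2 | C \<Rightarrow> 1 | D \<Rightarrow> sqrt 2 / 2) = 0"
      unfolding side_point_difference .
    have "case y of A \<Rightarrow> Re a = 0 | B \<Rightarrow> Re a = Im a | C \<Rightarrow> Im a = 0 | D \<Rightarrow> Im a = - Re a"
    proof (cases y)
      case B
      then have "(Im a - Re a) * (sqrt 2 / 2) = 0" using orth by (simp add: left_diff_distrib)
      then show ?thesis using B by simp
    next
      case D
      then have "(Im a + Re a) * (sqrt 2 / 2) = 0" using orth by (simp add: distrib_right)
      then show ?thesis using D by (simp add: eq_neg_iff_add_eq_0)
    qed (use orth in simp_all)
    then have "\<exists>c. \<forall>z. a \<bullet> z = c * outwardness y z"
      by (intro exI[of _ "if y = A then Im a else Re a"], cases y)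
        (simp_all add: inner_complex_def outwardness_def algebra_simps)
    then obtain c where c: "\<And>z. a \<bullet> z = c * outwardness y z" by blast
    have "c * outwardness y ?P = c * outwardness y ?Q" using ends unfolding c by argo
    then have "c = 0" using outwardness_reentry[OF assms, of y x] by simp
    then have "a \<bullet> a = 0" unfolding c by simp
    then show False using a by simp
  qed
qed

text \<open>This links the geometry to \<^const>\<open>midheight\<close>: for the direction \<open>Complex (h C) (h A)\<close> the left hand
  side is the height of a point of the exit side \<open>x\<close>.\<close>

lemma side_point_height:
  assumes "octagon_heights h"
  shows "h C * Im (side_point x \<kappa>) - h A * Re (side_point x \<kappa>) = midheight h x + \<kappa> * h x"
proof -
  have r: "sqrt 2 * h A = h B - h D" "sqrt 2 * h C = h B + h D"
    using octagon_heights_ratios[OF assms] by blast+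
  have "4 * (h C * Im (side_point x \<kappa>) - h A * Re (side_point x \<kappa>)) = 4 * (midheight h x + \<kappa> * h x)"
  proof (cases x)
    case A
    show ?thesis unfolding A using r side_point_coordinates(1,2)[of \<kappa>] midheight_table(1)[of h] by algebra
  next
    case B
    show ?thesis unfolding B using r side_point_coordinates(3,4)[of \<kappa>] midheight_table(2)[of h] by algebra
  next
    case C
    show ?thesis unfolding C using r side_point_coordinates(5,6)[of \<kappa>] midheight_table(3)[of h] by algebra
  next
    case D
    show ?thesis unfolding D using r side_point_coordinates(7,8)[of \<kappa>] midheight_table(4)[of h] by algebra
  qed
  then show ?thesis by simp
qed

lemma parallel_scaleR:
  assumes "v \<noteq> 0" "Re v * Im w = Im v * Re w"
  shows "w = ((w \<bullet> v) / (v \<bullet> v)) *\<^sub>R v"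
proof -
  have "(v \<bullet> v) *\<^sub>R w = (w \<bullet> v) *\<^sub>R v"
    using assms(2) by (simp add: complex_eq_iff inner_complex_def algebra_simps)
  then show ?thesis using assms(1)
    by (metis inner_eq_zero_iff divideR_right divide_inverse_commute scaleR_scaleR)
qed

definition realizable :: "(int \<Rightarrow> letter) \<Rightarrow> bool" where
  "realizable c \<longleftrightarrow> (\<exists>\<tau>. periodic_trajectory \<tau> \<and> cutting_sequence \<tau> c)"

text \<open>The transition rule of the orbit says that the re-entry point and the next exit point have the same
  height, so that they differ by a multiple of the direction. The multiple is positive since both
  this difference and the direction point outwards at the next exit side.\<close>

lemma octagon_coded_realizable:
  assumes "octagon_coded w"
  shows "realizable w"
proof -
  obtain h z where h: "octagon_heights h" and z: "periodic_orbit h z" and w: "w = fst \<circ> z"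
    using assms by (auto simp: octagon_coded_def)
  obtain N where hits: "\<And>n. hits h (z n)" and follows: "\<And>n. follows h (z n) (z (n + 1))"
    and N: "0 < N" "\<And>n. z (n + N) = z n"
    using z by (auto simp: periodic_orbit_def)
  define \<kappa> where "\<kappa> n = snd (z n) / h (w n)" for n
  have bound: "2 * \<bar>snd (z n)\<bar> < h (w n)" for n
    using hits[of n] by (simp add: hits_def w case_prod_beta)
  have h_pos: "0 < h (w n)" for n using bound[of n] by linarith
  have \<kappa>: "\<kappa> n * h (w n) = snd (z n)" "\<bar>\<kappa> n\<bar> < 1 / 2" for n
    using bound[of n] h_pos[of n] by (simp_all add: \<kappa>_def abs_divide field_simps)
  define v where "v = Complex (h C) (h A)"
  have "v \<noteq> 0" using h by (simp add: v_def octagon_heights_def complex_eq_iff)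
  define q where "q n = side_point (w n) (\<kappa> n)" for n
  define p where "p n = - side_point (w n) (- \<kappa> n)" for n
  define l where "l n = ((q (n + 1) - p n) \<bullet> v) / (v \<bullet> v)" for n
  have pq: "q (n + 1) - p n = l n *\<^sub>R v" for n
    unfolding l_def
  proof (rule parallel_scaleR[OF \<open>v \<noteq> 0\<close>])
    have "snd (z (n + 1)) = snd (z n) - midheight h (w n) - midheight h (w (n + 1))"
      using follows[of n] by (simp add: follows_def w case_prod_beta)
    then show "Re v * Im (q (n + 1) - p n) = Im v * Re (q (n + 1) - p n)"
      using side_point_height[OF h, of "w (n + 1)" "\<kappa> (n + 1)"] side_point_height[OF h, of "w n" "- \<kappa> n"]
        \<kappa>(1)[of n] \<kappa>(1)[of "n + 1"]
      by (simp add: v_def p_def q_def algebra_simps)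
  qed
  have l: "0 < l n" for n
  proof -
    let ?y = "w (n + 1)"
    have lin: "outwardness ?y (q (n + 1)) - outwardness ?y (p n) = l n * outwardness ?y v"
    proof -
      have "outwardness ?y (q (n + 1)) - outwardness ?y (p n) = outwardness ?y (q (n + 1) - p n)"
        by (cases ?y) (simp_all add: outwardness_def)
      also have "\<dots> = l n * outwardness ?y v"
        unfolding pq by (cases ?y) (simp_all add: outwardness_def algebra_simps)
      finally show ?thesis .
    qed
    have "outwardness ?y v = h ?y \<or> outwardness ?y v = sqrt 2 * h ?y"
      using h by (cases ?y) (simp_all add: outwardness_def v_def octagon_heights_def)
    then have "0 < outwardness ?y v" using h_pos[of "n + 1"] by auto
    moreover have "0 < l n * outwardness ?y v"
      using outwardness_reentry[of "- \<kappa> n" "\<kappa> (n + 1)" ?y "w n"] \<kappa>(2)[of n] \<kappa>(2)[of "n + 1"]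
      unfolding lin[symmetric] by (simp add: p_def q_def)
    ultimately show ?thesis by (simp add: zero_less_mult_iff)
  qed
  have w_N: "w (n + N) = w n" and \<kappa>_N: "\<kappa> (n + N) = \<kappa> n" for n
    using N(2) by (simp_all add: w \<kappa>_def)
  have p_N: "p (n + N) = p n" and q_N: "q (n + N) = q n" for n by (simp_all add: p_def q_def w_N \<kappa>_N)
  have "\<exists>\<tau> t. crossings \<tau> t (exit_side \<circ> w) \<and> (\<exists>T>0. \<forall>r. \<tau> (r + T) = \<tau> r)"
  proof (rule periodic_crossings[OF \<open>v \<noteq> 0\<close> l _ _ _ _ _ N(1)])
    show "q (n + 1) = p n + l n *\<^sub>R v" for n using pq[of n] by (simp add: algebra_simps)
    show "(exit_side \<circ> w) n \<in> {1..8}" for n by (cases "w n") (simp_all add: exit_side_table)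
    show "q n \<in> side ((exit_side \<circ> w) n)" for n using side_point_side[OF \<kappa>(2)] by (simp add: q_def)
    show "p n = glue ((exit_side \<circ> w) n) (q n)" for n by (simp add: p_def q_def glue_exit)
    show "open_segment (p n) (q (n + 1)) \<subseteq> interior octagon" for n
      unfolding p_def q_def by (rule segment_interior_octagon) (simp_all only: abs_minus \<kappa>(2))
    show "l (n + N) = l n" for n 
    proof -
      have "q (n + N + 1) = q (n + 1)" using q_N[of "n + 1"] by (simp add: add_ac)
      then show ?thesis unfolding l_def p_N by simp
    qed
  qed (rule p_N)
  then obtain \<tau> t T where "crossings \<tau> t (exit_side \<circ> w)" "0 < T" "\<And>r. \<tau> (r + T) = \<tau> r" by blast
  moreover have "side_label \<circ> (exit_side \<circ> w) = w"
  proof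
    show "(side_label \<circ> (exit_side \<circ> w)) n = w n" for n
      by (cases "w n") (simp_all add: exit_side_def side_label_def)
  qed
  ultimately show ?thesis
    unfolding realizable_def periodic_trajectory_def linear_trajectory_def cutting_sequence_def
    by metis
qed

section \<open>Symmetries of the octagon\<close>

text \<open>A linear map that permutes the sides of the octagon is compatible with the gluing and hence
  maps trajectories to trajectories; labels are permuted accordingly. Only the unordered pair of
  end points of a side matters, so reflections are included.\<close>

lemma realizable_symmetry:
  fixes \<rho> :: "complex \<Rightarrow> complex"
  assumes \<rho>: "linear \<rho>" "bij \<rho>"
    and f: "\<And>j. j \<in> {1..8} \<Longrightarrow> f j \<in> {1..8}"
    and vertices: "\<And>j. j \<in> {1..8} \<Longrightarrow> {\<rho> (vertex j), \<rho> (vertex (j + 1))} = {vertex (f j), vertex (f j + 1)}"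
    and label: "\<And>j. j \<in> {1..8} \<Longrightarrow> side_label (f j) = g (side_label j)"
    and c: "realizable c"
  shows "realizable (g \<circ> c)"
proof -
  have \<rho>_side: "\<rho> ` side j = side (f j)" if "j \<in> {1..8}" for j
  proof -
    have "\<rho> ` side j = open_segment (\<rho> (vertex j)) (\<rho> (vertex (j + 1)))"
      unfolding side_def by (rule open_segment_linear_image[OF \<rho>(1) bij_is_inj[OF \<rho>(2)], symmetric])
    also have "\<dots> = side (f j)"
      using vertices[OF that] unfolding side_def doubleton_eq_iff by (auto simp: open_segment_commute)
    finally show ?thesis .
  qed
  have \<rho>_glue: "\<rho> (glue j p) = glue (f j) (\<rho> p)" if "j \<in> {1..8}" for j p
  proof -
    have "\<rho> (vertex j) + \<rho> (vertex (j + 1)) = vertex (f j) + vertex (f j + 1)"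
      using vertices[OF that] unfolding doubleton_eq_iff by (auto simp: add.commute)
    then show ?thesis unfolding glue_def using \<rho>(1) by (simp add: linear_diff linear_add)
  qed
  have "\<rho> ` (vertex ` {1..8}) \<subseteq> vertex ` {1..8}"
  proof
    fix p assume "p \<in> \<rho> ` (vertex ` {1..8})"
    then obtain j where j: "j \<in> {1..8}" "p = \<rho> (vertex j)" by auto
    then have "p = vertex (f j) \<or> p = vertex (f j + 1)" using vertices[OF j(1)] by auto
    moreover have "f j \<in> {1..8}" "f j + 1 \<in> {1..8} \<or> f j + 1 = 9" using f[OF j(1)] by auto
    moreover have "vertex 9 \<in> vertex ` {1..8}" unfolding vertex_9 by auto
    ultimately show "p \<in> vertex ` {1..8}" by (elim disjE; simp only: imageI)
  qed
  then have "\<rho> ` (vertex ` {1..8}) = vertex ` {1..8}"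
    using inj_on_subset[OF bij_is_inj[OF \<rho>(2)]] by (intro endo_inj_surj) auto
  then have "\<rho> ` octagon = octagon"
    unfolding octagon_def by (simp add: convex_hull_linear_image[OF \<rho>(1)])
  then have \<rho>_interior: "\<rho> ` interior octagon = interior octagon"
    using interior_bijective_linear_image[OF \<rho>, of octagon] by simp
  have crossings: "crossings (\<rho> \<circ> \<tau>) t (f \<circ> \<sigma>)" if *: "crossings \<tau> t \<sigma>" for \<tau> t \<sigma>
  proof -
    have \<sigma>: "\<sigma> n \<in> {1..8}" for n using * by (simp add: crossings_def)
    obtain v where v: "v \<noteq> 0" and
      move: "\<And>n r. r \<in> {t n..<t (n + 1)} \<Longrightarrow> \<tau> r = \<tau> (t n) + (r - t n) *\<^sub>R v" and
      int: "\<And>n r. r \<in> {t n<..<t (n + 1)} \<Longrightarrow> \<tau> r \<in> interior octagon" and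
      side: "\<And>n. \<tau> (t n) + (t (n + 1) - t n) *\<^sub>R v \<in> side (\<sigma> (n + 1))" and
      gl: "\<And>n. \<tau> (t (n + 1)) = glue (\<sigma> (n + 1)) (\<tau> (t n) + (t (n + 1) - t n) *\<^sub>R v)"
      using * unfolding crossings_def Let_def by blast
    have lin: "\<rho> (p + x *\<^sub>R v) = \<rho> p + x *\<^sub>R \<rho> v" for p x
      using \<rho>(1) by (simp add: linear_add linear_scale)
    have "\<rho> v \<noteq> 0"
      using v bij_is_inj[OF \<rho>(2)] linear_0[OF \<rho>(1)] by (metis injD)
    moreover have "(\<rho> \<circ> \<tau>) r = (\<rho> \<circ> \<tau>) (t n) + (r - t n) *\<^sub>R \<rho> v" if "r \<in> {t n..<t (n + 1)}" for n r
      using move[OF that] by (simp add: lin)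
    moreover have "(\<rho> \<circ> \<tau>) r \<in> interior octagon" if "r \<in> {t n<..<t (n + 1)}" for n r
      using int[OF that] \<rho>_interior by auto
    moreover have "(\<rho> \<circ> \<tau>) (t n) + (t (n + 1) - t n) *\<^sub>R \<rho> v \<in> side ((f \<circ> \<sigma>) (n + 1))" for n
      using side[of n] \<rho>_side[OF \<sigma>[of "n + 1"]] by (auto simp: lin[symmetric])
    moreover have "(\<rho> \<circ> \<tau>) (t (n + 1)) = glue ((f \<circ> \<sigma>) (n + 1)) ((\<rho> \<circ> \<tau>) (t n) + (t (n + 1) - t n) *\<^sub>R \<rho> v)" for n
      using gl[of n] \<rho>_glue[OF \<sigma>[of "n + 1"]] by (simp add: lin[symmetric])
    moreover have "(f \<circ> \<sigma>) n \<in> {1..8}" for n using f[OF \<sigma>[of n]] by simp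
    ultimately show ?thesis using * unfolding crossings_def Let_def by blast
  qed
  obtain \<tau> where \<tau>: "periodic_trajectory \<tau>" "cutting_sequence \<tau> c" using c by (auto simp: realizable_def)
  then obtain t \<sigma> where \<sigma>: "crossings \<tau> t \<sigma>" "c = side_label \<circ> \<sigma>" by (auto simp: cutting_sequence_def)
  have "periodic_trajectory (\<rho> \<circ> \<tau>)"
    using \<tau>(1) crossings unfolding periodic_trajectory_def linear_trajectory_def by fastforce
  moreover have "g \<circ> c = side_label \<circ> (f \<circ> \<sigma>)"
  proof
    show "(g \<circ> c) n = (side_label \<circ> (f \<circ> \<sigma>)) n" for n
      using label[of "\<sigma> n"] \<sigma> by (simp add: crossings_def)
  qed
  then have "cutting_sequence (\<rho> \<circ> \<tau>) (g \<circ> c)"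
    using crossings[OF \<sigma>(1)] unfolding cutting_sequence_def by blast
  ultimately show ?thesis unfolding realizable_def by blast
qed

lemma nat_8_cases: "j \<in> {1..8} \<Longrightarrow> j \<in> {1, 2, 3, 4, 5, 6, 7, 8 :: nat}"
  by auto

lemma realizable_rotation:
  assumes "realizable c"
  shows "realizable (perm 2 \<circ> c)"
proof (rule realizable_symmetry[OF _ _ _ _ _ assms])
  let ?\<rho> = "\<lambda>p. cis (- (pi / 4)) * p" and ?f = "\<lambda>j :: nat. if j = 8 then 1 else j + 1"
  show "linear ?\<rho>" by (intro linearI) (simp_all add: algebra_simps)
  show "bij ?\<rho>"
    by (rule bij_betw_byWitness[where f' = "\<lambda>p. cis (pi / 4) * p"]) (simp_all add: mult.assoc[symmetric] cis_mult)
  fix j :: nat assume j: "j \<in> {1..8}"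
  show "?f j \<in> {1..8}" using j by auto
  show "{?\<rho> (vertex j), ?\<rho> (vertex (j + 1))} = {vertex (?f j), vertex (?f j + 1)}"
    unfolding vertex_rotate[symmetric] using vertex_9 vertex_opposite[of 2] vertex_opposite[of 6] by (auto simp: numeral_eq_Suc)
  show "side_label (?f j) = perm 2 (side_label j)"
    using nat_8_cases[OF j] by (elim insertE emptyE) (simp_all add: side_label_def perm_table)
qed

lemma vertex_reflect:
  "cis (pi / 4) * cnj (vertex 1) = vertex 5" "cis (pi / 4) * cnj (vertex 2) = vertex 4"
  "cis (pi / 4) * cnj (vertex 3) = vertex 3" "cis (pi / 4) * cnj (vertex 4) = vertex 2"
  "cis (pi / 4) * cnj (vertex 5) = vertex 1" "cis (pi / 4) * cnj (vertex 6) = vertex 8"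
  "cis (pi / 4) * cnj (vertex 7) = vertex 7" "cis (pi / 4) * cnj (vertex 8) = vertex 6"
  "cis (pi / 4) * cnj (vertex 9) = vertex 5"
  unfolding vertex_table cis_45 by (simp_all add: complex_eq_iff field_simps)

lemma realizable_reflection:
  assumes "realizable c"
  shows "realizable (perm 1 \<circ> c)"
proof (rule realizable_symmetry[OF _ _ _ _ _ assms])
  let ?\<rho> = "\<lambda>p. cis (pi / 4) * cnj p" and ?f = "\<lambda>j :: nat. if j \<le> 4 then 5 - j else 13 - j"
  show "linear ?\<rho>" by (intro linearI) (simp_all add: algebra_simps)
  have "?\<rho> (?\<rho> p) = p" for p by (simp add: mult.assoc[symmetric] cis_mult cis_cnj)
  then show "bij ?\<rho>" by (intro bij_betw_byWitness[where f' = ?\<rho>]) simp_all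
  fix j :: nat assume j: "j \<in> {1..8}"
  show "?f j \<in> {1..8}" using j by auto
  have "Suc (Suc 0) = 2" by simp
  then show "{?\<rho> (vertex j), ?\<rho> (vertex (j + 1))} = {vertex (?f j), vertex (?f j + 1)}"
    using nat_8_cases[OF j] vertex_9
    by (elim insertE emptyE) (simp_all add: vertex_reflect vertex_reflect(1)[unfolded One_nat_def] insert_commute numeral_2_eq_2[symmetric])
  show "side_label (?f j) = perm 1 (side_label j)"
    using nat_8_cases[OF j] by (elim insertE emptyE) (simp_all add: side_label_def perm_table)
qed

text \<open>The rotation \<open>\<pi>\<^sub>2\<close> and the reflection \<open>\<pi>\<^sub>1\<close> generate the group of the eight permutations.\<close>

lemma realizable_perm:
  assumes i: "i \<le> 7" and c: "realizable (perm i \<circ> c)"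
  shows "realizable c"
proof -
  let ?R = "perm 2" and ?S = "perm (Suc 0)"
  define sym where "sym g \<longleftrightarrow> (\<forall>c. realizable c \<longrightarrow> realizable (g \<circ> c))" for g
  have R: "sym ?R" and S: "sym ?S"
    unfolding sym_def using realizable_rotation realizable_reflection by simp_all
  have comp: "sym (g \<circ> h)" if "sym g" "sym h" for g h
    using that unfolding sym_def comp_assoc by blast
  \<comment> \<open>The entry with index \<open>i\<close> is the inverse of \<open>perm i\<close> as a product of generators.\<close>
  define g where "g = [id, ?S, ?R \<circ> (?R \<circ> ?R), ?S \<circ> ?R, ?R \<circ> ?R, ?S \<circ> (?R \<circ> ?R), ?R, ?R \<circ> ?S] ! i"
  have "sym g"
    using less_8_cases[OF i] unfolding g_def
    by (elim insertE emptyE) (simp_all add: comp R S, simp_all add: sym_def)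
  moreover have "g \<circ> (perm i \<circ> c) = c"
  proof
    fix n
    show "(g \<circ> (perm i \<circ> c)) n = c n"
      using less_8_cases[OF i] unfolding g_def
      by (elim insertE emptyE; cases "c n"; simp add: perm_table)
  qed
  ultimately show ?thesis using c unfolding sym_def by metis
qed

section \<open>Realization of finite subwords\<close>

lemma subword_realized:
  assumes "realizable c" "subword u c"
  shows "realized_by_periodic_trajectory u"
proof -
  obtain \<tau> t \<sigma> where \<tau>: "periodic_trajectory \<tau>" and cr: "crossings \<tau> t \<sigma>" and c: "c = side_label \<circ> \<sigma>"
    using assms(1) by (auto simp: realizable_def cutting_sequence_def)
  obtain m l where u: "u = map c [m..l]" using assms(2) by (auto simp: subword_def)
  have mono: "strict_mono t" using cr by (simp add: crossings_def)
  show ?thesis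
  proof (cases "m \<le> l")
    case True
    have "{n. t m \<le> t n \<and> t n \<le> t l} = {m..l}" by (auto simp: strict_mono_less_eq[OF mono])
    then have "piece_cutting_word \<tau> (t m) (t l) u"
      unfolding piece_cutting_word_def using cr u c
      by (intro exI[of _ t] exI[of _ \<sigma>] exI[of _ m] exI[of _ l]) simp
    moreover have "t m \<le> t l" using True by (simp add: strict_mono_less_eq[OF mono])
    ultimately show ?thesis unfolding realized_by_periodic_trajectory_def using \<tau> by blast
  next
    case False
    \<comment> \<open>The empty word is seen at an instant strictly between two crossings.\<close>
    obtain a where a: "t 0 < a" "a < t 1" using dense strict_monoD[OF mono, of 0 1] by auto
    have "\<not> (a \<le> t n \<and> t n \<le> a)" for n
      using a strict_mono_less[OF mono, of 0 n] strict_mono_less[OF mono, of n 1] by auto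
    then have "{n. a \<le> t n \<and> t n \<le> a} = {1..0}" by auto
    moreover have "u = map (side_label \<circ> \<sigma>) [1..0]" using False by (simp add: u)
    ultimately have "piece_cutting_word \<tau> a a u"
      unfolding piece_cutting_word_def using cr
      by (intro exI[of _ t] exI[of _ \<sigma>] exI[of _ 1] exI[of _ 0]) simp
    then show ?thesis unfolding realized_by_periodic_trajectory_def using \<tau> by blast
  qed
qed

lemma subword_of_generated_word:
  assumes s: "s \<in> Sstar" and w: "infinitely_coherent_wrt w s" and u: "subword u w"
  shows "\<exists>c\<in>(\<Union>k. generated_words s k). subword u c"
proof -
  obtain m l where ml: "u = map w [m..l]" using u by (auto simp: subword_def)
  have "s k \<le> 7" for k using s by (cases k) (auto simp: Sstar_def)
  moreover have "coherent (coherence_word s w k) (s k) (s (Suc k))" for k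
    using w by (simp add: infinitely_coherent_wrt_def)
  \<comment> \<open>The window is enlarged so as to contain at least two letters.\<close>
  ultimately have "\<exists>k. \<exists>z\<in>periodic_words (s k). \<exists>d. \<forall>i\<in>{m..max l (m + 1)}. gen_iter s k z (i + d) = w i"
    by (intro coherent_window) simp_all
  then obtain k z d where z: "z \<in> periodic_words (s k)"
    and d: "\<forall>i\<in>{m..max l (m + 1)}. gen_iter s k z (i + d) = w i" by blast
  have "u = map (gen_iter s k z) [m + d..l + d]"
  proof (rule nth_equalityI)
    show "u ! i = map (gen_iter s k z) [m + d..l + d] ! i" if "i < length u" for i
    proof -
      have "m + int i \<le> l" using that by (simp add: ml)
      then show ?thesis using d[rule_format, of "m + int i"] by (simp add: ml add_ac)
    qed
  qed (simp add: ml)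
  then show ?thesis using z by (auto simp: subword_def generated_words_def)
qed

lemma realizable_generated_words:
  assumes "s \<in> Sstar" "c \<in> generated_words s k"
  shows "realizable c"
proof (rule realizable_perm)
  show "s 0 \<le> 7" using assms(1) by (simp add: Sstar_def)
  show "realizable (perm (s 0) \<circ> c)"
    using assms by (intro octagon_coded_realizable octagon_coded_generated_words)
qed

theorem proposition2p4p21:
  fixes w :: "int \<Rightarrow> letter"
  assumes "infinitely_coherent w"
  shows "(\<forall>u. subword u w \<longrightarrow> realized_by_periodic_trajectory u) \<and>
    (\<forall>s\<in>Sstar. infinitely_coherent_wrt w s \<longrightarrow>
      (\<forall>u. subword u w \<longrightarrow>
        (\<exists>c\<in>(\<Union>k. generated_words s k).
          (\<exists>\<tau>. periodic_trajectory \<tau> \<and> cutting_sequence \<tau> c) \<and> subword u c)))"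
proof -
  have generated: "\<exists>c\<in>(\<Union>k. generated_words s k). realizable c \<and> subword u c"
    if "s \<in> Sstar" "infinitely_coherent_wrt w s" "subword u w" for s u
    using subword_of_generated_word[OF that] realizable_generated_words[OF that(1)] by blast
  moreover have "realized_by_periodic_trajectory u" if "subword u w" for u
    using assms generated subword_realized that unfolding infinitely_coherent_def by blast
  ultimately show ?thesis unfolding realizable_def by blast
qed

end
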